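(* Let $\mathcal{M}$ be a class of matroids closed under minors and isomorphism, let $k\ge 1$, and let $N\in\mathcal{M}$ be a simple and cosimple matroid with an exact $k$-separation $(A,B)$ such that $A$ is a union of circuits of $N$ and also a union of cocircuits of $N$. Suppose that the following hold for every $M\in\mathcal{M}$. (i) If $M$ is a simple single-element extension of $N$, with $M\backslash e=N$, then $\lambda_M(A)=k-1$ or $\lambda_M(A\cup e)=k-1$. (ii) If $M$ is a cosimple single-element coextension of $N$, with $M/f=N$, then $\lambda_M(A)=k-1$ or $\lambda_M(A\cup f)=k-1$. (iii) If $M$ is a cosimple single-element coextension, by an element $f$, of a simple single-element extension of $N$ by an element $e$, or $M$ is a simple single-element extension, by an element $e$, of a cosimple single-element coextension of $N$ by an element $f$ (so that $M\backslash e/f=N$), then at least one of the following holds: (a) $\lambda_{M/f}(A)=k-1$ and $\lambda_{M\backslash e}(A)=k-1$; (b) $\lambda_{M/f}(A)=k-1$ and $\lambda_{M\backslash e}(A\cup f)=k-1$, and moreover either $\lambda_M(A\cup f)=k-1$ or there is $g\in A$ such that $\{e,f,g\}$ is a triad or a triangle of $M$; (c) $\lambda_{M/f}(A\cup e)=k-1$ and $\lambda_{M\backslash e}(A)=k-1$, and moreover either $\lambda_M(A\cup e)=k-1$ or there is $g\in A$ such that $\{e,f,g\}$ is a triad or a triangle of $M$; (d) $\lambda_{M/f}(A\cup e)=k-1$ and $\lambda_{M\backslash e}(A\cup f)=k-1$, and moreover there is $g\in A$ such that $\{e,f,g\}$ is a triangle or a triad of $M$. Then $N$ is a $k$-decomposer,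 with inducer $(A,B)$, for every matroid in $\mathcal{M}$ with an $N$-minor.
   Context: For a matroid $M$ on ground set $E$ with rank function $r=r_M$ and $X\subseteq E$, the connectivity function is $\lambda_M(X)=r(X)+r(E-X)-r(M)$. For $k\ge 1$, a partition $(A,B)$ of $E$ is a $k$-separation if $|A|\ge k$, $|B|\ge k$ and $\lambda_M(A)\le k-1$; it is an exact $k$-separation if moreover $\lambda_M(A)=k-1$. $M$ is a single-element extension of $N$ (by $e$) if $M\backslash e=N$, and a single-element coextension of $N$ (by $f$) if $M/f=N$. A simple single-element extension is one where the larger matroid $M$ is simple (no loops or parallel pairs); a cosimple single-element coextension is one where the larger matroid $M$ is cosimple (no coloops or series pairs). A triangle is a 3-element circuit, a triad is a 3-element cocircuit. $A\cup e$ means $A\cup\{e\}$. If $N\in\mathcal{M}$ has an exact $k$-separation $(A,B)$ and $M\in\mathcal{M}$ has $N$ as a minor (if only a minor isomorphic to $N$ is given, identify it with $N$, so that $E(N)\subseteq E(M)$), then $N$ is a $k$-decomposer for $M$ having $(A,B)$ as an inducer if $M$ has an exact $k$-separation $(X,Y)$ with $A\subseteq X$ and $B\subseteq Y$. *)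

theory Defs
  imports Main
begin

section \<open>Matroids\<close>

text \<open>All matroids are finite. The library has no matroids, so a matroid is a record of a ground
  set and an independence predicate that satisfies the predicate \<open>matroid\<close> below. Since independent
  sets are required to lie in the ground set, record equality is equality of matroids.\<close>

record 'a indep_system =
  ground :: "'a set"
  indep :: "'a set \<Rightarrow> bool"

definition matroid :: "'a indep_system \<Rightarrow> bool" where
  "matroid M \<longleftrightarrow>
     finite (ground M) \<and>
     (\<forall>I. indep M I \<longrightarrow> I \<subseteq> ground M) \<and>
     indep M {} \<and>
     (\<forall>I J. indep M J \<and> I \<subseteq> J \<longrightarrow> indep M I) \<and>
     (\<forall>I J. indep M I \<and> indep M J \<and> card I < card J \<longrightarrow> (\<exists>x\<in>J - I. indep M (insert x I)))"

definition rank :: "'a indep_system \<Rightarrow> 'a set \<Rightarrow> nat" where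
  "rank M X = Max {card I | I. I \<subseteq> X \<and> indep M I}"

definition circuit :: "'a indep_system \<Rightarrow> 'a set \<Rightarrow> bool" where
  "circuit M C \<longleftrightarrow> C \<subseteq> ground M \<and> \<not> indep M C \<and> (\<forall>D. D \<subset> C \<longrightarrow> indep M D)"

definition base :: "'a indep_system \<Rightarrow> 'a set \<Rightarrow> bool" where
  "base M B \<longleftrightarrow> indep M B \<and> (\<forall>I. indep M I \<and> B \<subseteq> I \<longrightarrow> I = B)"

text \<open>The bases of the dual are the complements of the bases of \<open>M\<close>.\<close>

definition dual :: "'a indep_system \<Rightarrow> 'a indep_system" where
  "dual M = \<lparr>ground = ground M, indep = (\<lambda>I. \<exists>B. base M B \<and> I \<subseteq> ground M - B)\<rparr>"

definition delete :: "'a indep_system \<Rightarrow> 'a set \<Rightarrow> 'a indep_system" where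
  "delete M D = \<lparr>ground = ground M - D, indep = (\<lambda>I. indep M I \<and> I \<subseteq> ground M - D)\<rparr>"

definition contract :: "'a indep_system \<Rightarrow> 'a set \<Rightarrow> 'a indep_system" where
  "contract M C = dual (delete (dual M) C)"

definition minor :: "'a indep_system \<Rightarrow> 'a indep_system \<Rightarrow> bool" where
  "minor N M \<longleftrightarrow>
     (\<exists>C D. C \<subseteq> ground M \<and> D \<subseteq> ground M \<and> C \<inter> D = {} \<and> N = delete (contract M C) D)"

definition matroid_iso :: "('a \<Rightarrow> 'a) \<Rightarrow> 'a indep_system \<Rightarrow> 'a indep_system \<Rightarrow> bool" where
  "matroid_iso \<phi> M M' \<longleftrightarrow>
     bij_betw \<phi> (ground M) (ground M') \<and>
     (\<forall>X. X \<subseteq> ground M \<longrightarrow> (indep M' (\<phi> ` X) \<longleftrightarrow> indep M X))"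

definition minor_closed :: "'a indep_system set \<Rightarrow> bool" where
  "minor_closed \<M> \<longleftrightarrow> (\<forall>M\<in>\<M>. \<forall>N. minor N M \<longrightarrow> N \<in> \<M>)"

definition iso_closed :: "'a indep_system set \<Rightarrow> bool" where
  "iso_closed \<M> \<longleftrightarrow> (\<forall>M\<in>\<M>. \<forall>M' \<phi>. matroid M' \<and> matroid_iso \<phi> M M' \<longrightarrow> M' \<in> \<M>)"

abbreviation cocircuit :: "'a indep_system \<Rightarrow> 'a set \<Rightarrow> bool" where
  "cocircuit M C \<equiv> circuit (dual M) C"

definition triangle :: "'a indep_system \<Rightarrow> 'a set \<Rightarrow> bool" where
  "triangle M T \<longleftrightarrow> circuit M T \<and> card T = 3"

definition triad :: "'a indep_system \<Rightarrow> 'a set \<Rightarrow> bool" where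
  "triad M T \<longleftrightarrow> cocircuit M T \<and> card T = 3"

definition simple_matroid :: "'a indep_system \<Rightarrow> bool" where
  "simple_matroid M \<longleftrightarrow>
     (\<forall>x. \<not> circuit M {x}) \<and> (\<forall>x y. x \<noteq> y \<longrightarrow> \<not> circuit M {x, y})"

text \<open>Coloops and series pairs are the loops and parallel pairs of the dual.\<close>

definition cosimple_matroid :: "'a indep_system \<Rightarrow> bool" where
  "cosimple_matroid M \<longleftrightarrow>
     (\<forall>x. \<not> cocircuit M {x}) \<and> (\<forall>x y. x \<noteq> y \<longrightarrow> \<not> cocircuit M {x, y})"

definition simple_extension :: "'a indep_system \<Rightarrow> 'a \<Rightarrow> 'a indep_system \<Rightarrow> bool" where
  "simple_extension M e N \<longleftrightarrow> simple_matroid M \<and> e \<in> ground M \<and> delete M {e} = N"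

definition cosimple_coextension :: "'a indep_system \<Rightarrow> 'a \<Rightarrow> 'a indep_system \<Rightarrow> bool" where
  "cosimple_coextension M f N \<longleftrightarrow> cosimple_matroid M \<and> f \<in> ground M \<and> contract M {f} = N"

section \<open>Separations and decomposers\<close>

text \<open>The connectivity function is integer-valued, to avoid truncated subtraction on \<open>nat\<close>.\<close>

definition connectivity :: "'a indep_system \<Rightarrow> 'a set \<Rightarrow> int" where
  "connectivity M X = int (rank M X) + int (rank M (ground M - X)) - int (rank M (ground M))"

definition k_separation :: "nat \<Rightarrow> 'a indep_system \<Rightarrow> 'a set \<Rightarrow> 'a set \<Rightarrow> bool" where
  "k_separation k M A B \<longleftrightarrow>
     A \<union> B = ground M \<and> A \<inter> B = {} \<and> k \<le> card A \<and> k \<le> card B \<and>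
     connectivity M A \<le> int k - 1"

definition exact_k_separation :: "nat \<Rightarrow> 'a indep_system \<Rightarrow> 'a set \<Rightarrow> 'a set \<Rightarrow> bool" where
  "exact_k_separation k M A B \<longleftrightarrow> k_separation k M A B \<and> connectivity M A = int k - 1"

text \<open>Here \<open>N\<close> is literally a minor of \<open>M\<close>, so \<open>ground N \<subseteq> ground M\<close>. A minor that is only isomorphic
  to \<open>N\<close> is handled by transporting \<open>N\<close>, \<open>A\<close> and \<open>B\<close> along the isomorphism.\<close>

definition k_decomposer ::
  "nat \<Rightarrow> 'a indep_system \<Rightarrow> 'a indep_system \<Rightarrow> 'a set \<Rightarrow> 'a set \<Rightarrow> bool" where
  "k_decomposer k N M A B \<longleftrightarrow>
     exact_k_separation k N A B \<and> minor N M \<and>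
     (\<exists>X Y. exact_k_separation k M X Y \<and> A \<subseteq> X \<and> B \<subseteq> Y)"

section \<open>The operations preserve matroids\<close>

lemma matroidI:
  assumes "finite (ground M)" "\<And>I. indep M I \<Longrightarrow> I \<subseteq> ground M" "indep M {}"
    "\<And>I J. indep M J \<Longrightarrow> I \<subseteq> J \<Longrightarrow> indep M I"
    "\<And>I J. indep M I \<Longrightarrow> indep M J \<Longrightarrow> card I < card J \<Longrightarrow> \<exists>x\<in>J - I. indep M (insert x I)"
  shows "matroid M"
  unfolding matroid_def using assms by (intro conjI) blast+

lemma matroidD:
  assumes "matroid M"
  shows "finite (ground M)" "indep M I \<Longrightarrow> I \<subseteq> ground M" "indep M {}"
    "indep M J \<Longrightarrow> I \<subseteq> J \<Longrightarrow> indep M I"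
    "indep M I \<Longrightarrow> indep M J \<Longrightarrow> card I < card J \<Longrightarrow> \<exists>x\<in>J - I. indep M (insert x I)"
  using assms unfolding matroid_def by (elim conjE; blast)+

lemma matroid_delete:
  assumes M: "matroid M" shows "matroid (delete M D)"
proof -
  have fin: "finite (ground M)" and e: "indep M {}"
    and her: "\<And>I J. indep M J \<Longrightarrow> I \<subseteq> J \<Longrightarrow> indep M I"
    and aug: "\<And>I J. indep M I \<Longrightarrow> indep M J \<Longrightarrow> card I < card J \<Longrightarrow> \<exists>x\<in>J - I. indep M (insert x I)"
    by (fact matroidD[OF M])+
  have "\<exists>x\<in>J - I. indep (delete M D) (insert x I)"
    if "indep (delete M D) I" "indep (delete M D) J" "card I < card J" for I J
    using aug[of I J] that by (auto simp: delete_def)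
  moreover have "indep (delete M D) I" if "indep (delete M D) J" "I \<subseteq> J" for I J
    using her[of J I] that by (auto simp: delete_def)
  moreover have "indep (delete M D) {}" "finite (ground (delete M D))"
    "indep (delete M D) I \<Longrightarrow> I \<subseteq> ground (delete M D)" for I
    using e fin by (auto simp: delete_def)
  ultimately show ?thesis by (intro matroidI)
qed

lemma indep_extend:
  assumes M: "matroid M" and I: "indep M I" and J: "indep M J"
  shows "\<exists>K. I \<subseteq> K \<and> K \<subseteq> I \<union> J \<and> indep M K \<and> card J \<le> card K"
proof -
  have fin: "finite (ground M)" and sub: "\<And>I. indep M I \<Longrightarrow> I \<subseteq> ground M"
    and aug: "\<And>I J. indep M I \<Longrightarrow> indep M J \<Longrightarrow> card I < card J \<Longrightarrow> \<exists>x\<in>J - I. indep M (insert x I)"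
    by (fact matroidD[OF M])+
  from I show ?thesis
  proof (induction "card J - card I" arbitrary: I rule: less_induct)
    case less
    show ?case
    proof (cases "card I < card J")
      case True
      then obtain x where x: "x \<in> J - I" "indep M (insert x I)"
        using aug less.prems J by blast
      have "finite I" using sub[OF less.prems] fin finite_subset by blast
      then have "card J - card (insert x I) < card J - card I"
        using x True by simp
      from less.hyps[OF this x(2)] x show ?thesis by blast
    next
      case False
      then show ?thesis using less.prems by (intro exI[of _ I]) auto
    qed
  qed
qed

lemma base_card_eq:
  assumes M: "matroid M" and B: "base M B" and B': "base M B'"
  shows "card B = card B'"
proof -
  have aux: "card C' \<le> card C" if "base M C" "base M C'" for C C'
    using indep_extend[OF M, of C C'] that unfolding base_def by blast
  show ?thesis using aux[OF B B'] aux[OF B' B] by simp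
qed

lemma base_of_card:
  assumes M: "matroid M" and B: "base M B" and I: "indep M I" and c: "card B \<le> card I"
  shows "base M I"
proof -
  have fin: "finite (ground M)" and sub: "\<And>I. indep M I \<Longrightarrow> I \<subseteq> ground M"
    by (fact matroidD[OF M])+
  have "J = I" if J: "indep M J" "I \<subseteq> J" for J
  proof -
    obtain K where K: "B \<subseteq> K" "indep M K" "card J \<le> card K"
      using indep_extend[OF M, of B J] B J unfolding base_def by blast
    have "K = B" using B K unfolding base_def by blast
    then have "card J \<le> card I" using K c by simp
    moreover have "finite J" using sub[OF J(1)] fin finite_subset by blast
    ultimately show ?thesis using J(2) card_seteq by metis
  qed
  then show ?thesis using I unfolding base_def by blast
qed

lemma base_exists:
  assumes M: "matroid M" shows "\<exists>B. base M B"
proof -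
  have fin: "finite (ground M)" and sub: "\<And>I. indep M I \<Longrightarrow> I \<subseteq> ground M" and e: "indep M {}"
    by (fact matroidD[OF M])+
  have "finite {I. indep M I}"
    by (rule finite_subset[of _ "Pow (ground M)"]) (use fin sub in auto)
  then obtain B where "B \<in> {I. indep M I}" "\<And>I. I \<in> {I. indep M I} \<Longrightarrow> B \<subseteq> I \<Longrightarrow> B = I"
    using finite_has_maximal[of "{I. indep M I}"] e by blast
  then show ?thesis unfolding base_def by blast
qed

lemma matroid_dual:
  assumes M: "matroid M" shows "matroid (dual M)"
proof -
  have fin: "finite (ground M)" and sub: "\<And>I. indep M I \<Longrightarrow> I \<subseteq> ground M"
    and her: "\<And>I J. indep M J \<Longrightarrow> I \<subseteq> J \<Longrightarrow> indep M I"
    by (fact matroidD[OF M])+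
  have aug: "\<exists>x\<in>J - I. indep (dual M) (insert x I)"
    if I: "indep (dual M) I" and J: "indep (dual M) J" and c: "card I < card J" for I J
  proof -
    obtain B1 where B1: "base M B1" "I \<subseteq> ground M - B1" using I by (auto simp: dual_def)
    obtain B2 where B2: "base M B2" "J \<subseteq> ground M - B2" using J by (auto simp: dual_def)
    have fI: "finite I" and fJ: "finite J"
      using finite_subset[OF B1(2)] finite_subset[OF B2(2)] fin by simp_all
    have iB: "indep M B1" "indep M B2" using B1 B2 by (auto simp: base_def)
    have fB2: "finite B2" using sub[OF iB(2)] fin finite_subset by blast
    have "indep M (B2 - I)" using her[OF iB(2)] by blast
    then obtain B where B: "B2 - I \<subseteq> B" "B \<subseteq> (B2 - I) \<union> B1" "indep M B" "card B1 \<le> card B"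
      using indep_extend[OF M _ iB(1), of "B2 - I"] by blast
    have bB: "base M B" using base_of_card[OF M B1(1) B(3,4)] .
    have disj: "I \<inter> B = {}" using B(2) B1(2) by blast
    have fB: "finite B" using sub[OF B(3)] fin finite_subset by blast
    have "\<not> J - I \<subseteq> B"
    proof
      assume JB: "J - I \<subseteq> B"
      have "card (J - I) + card (B2 - I) = card ((J - I) \<union> (B2 - I))"
        using fJ fB2 B2(2) by (subst card_Un_disjoint) auto
      also have "\<dots> \<le> card B" using JB B(1) fB by (intro card_mono) auto
      also have "\<dots> = card B2" using base_card_eq[OF M bB B2(1)] .
      also have "\<dots> = card (B2 - I) + card (B2 \<inter> I)"
        using fB2 by (metis add.commute card_Int_Diff)
      finally have 1: "card (J - I) \<le> card (B2 \<inter> I)" by simp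
      have 2: "card (B2 \<inter> I) \<le> card (I - J)" using fI B2(2) by (intro card_mono finite_Diff) blast+
      have "card (J - I) + card (I \<inter> J) = card J" "card (I - J) + card (I \<inter> J) = card I"
        using card_Int_Diff[OF fJ, of I] card_Int_Diff[OF fI, of J] by (simp_all add: Int_commute)
      then show False using 1 2 c by linarith
    qed
    then obtain x where x: "x \<in> J - I" "x \<notin> B" by blast
    have "insert x I \<subseteq> ground M - B" using x disj B1(2) B2(2) by blast
    then have "indep (dual M) (insert x I)" using bB unfolding dual_def indep_system.simps by (intro exI[of _ B] conjI)
    then show ?thesis using x by blast
  qed
  have "indep (dual M) {}" using base_exists[OF M] by (auto simp: dual_def)
  moreover have "indep (dual M) I \<Longrightarrow> I \<subseteq> ground (dual M)" for I by (auto simp: dual_def)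
  moreover have "indep (dual M) J \<Longrightarrow> I \<subseteq> J \<Longrightarrow> indep (dual M) I" for I J
    by (auto simp: dual_def)
  moreover have "finite (ground (dual M))" using fin by (simp add: dual_def)
  ultimately show ?thesis using aug by (intro matroidI)
qed

lemma matroid_contract: "matroid M \<Longrightarrow> matroid (contract M C)"
  unfolding contract_def by (intro matroid_dual matroid_delete)

end

theory Submission
  imports Defs "HOL-Combinatorics.Transposition"
begin

text \<open>
  Take a counterexample \<open>M\<close> with as few elements as possible, over all classes satisfying the
  hypotheses and all \<open>N\<close>; write \<open>N = M / C \ D\<close>. By minimality every one-element removal that keeps
  \<open>N\<close> as a minor induces \<open>(A, B)\<close>, and uncrossing shows that each element outside \<open>N\<close> can be removed
  in only one way. Submodularity then orders these elements linearly, like a shortest augmenting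
  path: the separation that appears when \<open>z\<close> is removed has exactly the predecessors of \<open>z\<close> on the side
  of \<open>A\<close>, and deleted and contracted elements alternate.

  No element \<open>v\<close> of \<open>D\<close> is parallel to an element \<open>a\<close> of \<open>A\<close> when put back alone, since exchanging
  \<open>v\<close> and \<open>a\<close> gives a copy of \<open>N\<close> that is a minor of \<open>M \ a\<close> and contradicts minimality; dually for
  \<open>C\<close> and series pairs. Up to duality the first element \<open>e\<close> lies in \<open>D\<close>, and the second one, \<open>f\<close>, in
  \<open>C\<close>. The exchange property makes \<open>N\<close> plus \<open>e\<close> simple and \<open>N\<close> plus \<open>e\<close> and \<open>f\<close> cosimple, and it
  excludes the triangles and triads of (iii); the remaining alternatives of (i) and (iii) contradict
  the position of \<open>e\<close> and \<open>f\<close> in the order.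
\<close>

section \<open>Rank\<close>

lemma ground_simps [simp]:
  "ground (dual M) = ground M" "ground (delete M D) = ground M - D"
  "ground (contract M C) = ground M - C"
  by (simp_all add: dual_def delete_def contract_def)

lemma finite_indep_cards: "matroid M \<Longrightarrow> finite {card I | I. I \<subseteq> X \<and> indep M I}"
proof -
  assume M: "matroid M"
  have "{card I | I. I \<subseteq> X \<and> indep M I} \<subseteq> card ` Pow (ground M)"
    using matroidD(2)[OF M] by auto
  then show ?thesis using matroidD(1)[OF M] by (meson finite_Pow_iff finite_imageI finite_subset)
qed

lemma card_le_rank: "matroid M \<Longrightarrow> indep M I \<Longrightarrow> I \<subseteq> X \<Longrightarrow> card I \<le> rank M X"
  unfolding rank_def by (rule Max_ge[OF finite_indep_cards]) auto

lemma rank_obtain: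
  assumes "matroid M" obtains I where "indep M I" "I \<subseteq> X" "card I = rank M X"
proof -
  have "rank M X \<in> {card I | I. I \<subseteq> X \<and> indep M I}"
    unfolding rank_def using matroidD(3)[OF assms]
    by (intro Max_in finite_indep_cards assms) auto
  then show ?thesis using that by auto
qed

lemma rank_mono: "matroid M \<Longrightarrow> X \<subseteq> Y \<Longrightarrow> rank M X \<le> rank M Y"
  by (metis card_le_rank rank_obtain subset_trans)

lemma indep_finite: "matroid M \<Longrightarrow> indep M I \<Longrightarrow> finite I"
  using matroidD(1,2) finite_subset by metis

lemma rank_le_card: "matroid M \<Longrightarrow> finite X \<Longrightarrow> rank M X \<le> card X"
  by (metis card_mono rank_obtain)

lemma rank_indep: "matroid M \<Longrightarrow> indep M I \<Longrightarrow> rank M I = card I"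
  by (meson card_le_rank dual_order.antisym indep_finite order_refl rank_le_card)

lemma indep_iff_rank: "matroid M \<Longrightarrow> finite X \<Longrightarrow> indep M X \<longleftrightarrow> rank M X = card X"
  by (metis card_subset_eq rank_indep rank_obtain)

lemma rank_empty [simp]: "matroid M \<Longrightarrow> rank M {} = 0"
  using rank_le_card[of M "{}"] by simp

lemma rank_extend:
  assumes M: "matroid M" and I: "indep M I" "I \<subseteq> X"
  obtains J where "indep M J" "I \<subseteq> J" "J \<subseteq> X" "card J = rank M X"
proof -
  obtain K where K: "indep M K" "K \<subseteq> X" "card K = rank M X" by (rule rank_obtain[OF M])
  obtain J where J: "I \<subseteq> J" "J \<subseteq> I \<union> K" "indep M J" "card K \<le> card J"
    using indep_extend[OF M I(1) K(1)] by blast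
  have "J \<subseteq> X" using I K J by blast
  moreover from this have "card J = rank M X" using J(4) K(3) card_le_rank[OF M J(3)] by (simp add: le_antisym)
  ultimately show ?thesis using that J by blast
qed

lemma rank_submod:
  assumes M: "matroid M"
  shows "rank M (X \<inter> Y) + rank M (X \<union> Y) \<le> rank M X + rank M Y"
proof -
  obtain I where I: "indep M I" "I \<subseteq> X \<inter> Y" "card I = rank M (X \<inter> Y)" by (rule rank_obtain[OF M])
  obtain J where J: "indep M J" "I \<subseteq> J" "J \<subseteq> X \<union> Y" "card J = rank M (X \<union> Y)"
    using rank_extend[OF M I(1), of "X \<union> Y"] I(2) by blast
  have f: "finite J" using indep_finite[OF M J(1)] .
  have h: "indep M K" if "K \<subseteq> J" for K using matroidD(4)[OF M J(1) that] .
  have "card I \<le> card (J \<inter> X \<inter> Y)" using I J f by (intro card_mono) auto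
  moreover have "card (J \<inter> X) + card (J \<inter> Y) = card J + card (J \<inter> X \<inter> Y)"
  proof -
    have "(J \<inter> X) \<union> (J \<inter> Y) = J" "(J \<inter> X) \<inter> (J \<inter> Y) = J \<inter> X \<inter> Y" using J(3) by auto
    then show ?thesis using card_Un_Int[of "J \<inter> X" "J \<inter> Y"] f by simp
  qed
  moreover have "card (J \<inter> X) \<le> rank M X" "card (J \<inter> Y) \<le> rank M Y"
    by (intro card_le_rank[OF M h]; blast)+
  ultimately show ?thesis using I J by linarith
qed

lemma rank_submod':
  assumes "matroid M" "U \<subseteq> X \<inter> Y" "V \<subseteq> X \<union> Y"
  shows "rank M U + rank M V \<le> rank M X + rank M Y"
  using rank_submod[OF assms(1), of X Y] rank_mono[OF assms(1,2)] rank_mono[OF assms(1,3)] by linarith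

lemma rank_Un_le: "matroid M \<Longrightarrow> finite Y \<Longrightarrow> rank M (X \<union> Y) \<le> rank M X + card Y"
  using rank_submod'[of M "{}" X Y "X \<union> Y"] rank_le_card[of M Y] by simp

lemma rank_insert_le: "matroid M \<Longrightarrow> rank M (insert x X) \<le> rank M X + 1"
  using rank_Un_le[of M "{x}" X] by simp

lemma rank_insert_mono:
  assumes "matroid M" "X \<subseteq> Y" "rank M (insert x X) = rank M X"
  shows "rank M (insert x Y) = rank M Y"
proof -
  have "rank M X + rank M (insert x Y) \<le> rank M (insert x X) + rank M Y"
    by (rule rank_submod') (use assms in auto)
  then show ?thesis using assms(3) rank_mono[OF assms(1), of Y "insert x Y"] by force
qed

lemma base_iff_rank:
  assumes M: "matroid M"
  shows "base M B \<longleftrightarrow> indep M B \<and> card B = rank M (ground M)"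
proof
  assume B: "base M B"
  then have i: "indep M B" by (simp add: base_def)
  obtain J where "indep M J" "B \<subseteq> J" "J \<subseteq> ground M" "card J = rank M (ground M)"
    using rank_extend[OF M i matroidD(2)[OF M i]] by blast
  then show "indep M B \<and> card B = rank M (ground M)" using B by (auto simp: base_def)
next
  assume B: "indep M B \<and> card B = rank M (ground M)"
  show "base M B" unfolding base_def
  proof (intro conjI allI impI)
    fix I assume I: "indep M I \<and> B \<subseteq> I"
    then have "card I \<le> card B" using B card_le_rank[OF M _ matroidD(2)[OF M]] by metis
    then show "I = B" using I card_seteq indep_finite[OF M] by metis
  qed (use B in blast)
qed

lemma matroid_eqI:
  assumes "matroid M" "matroid N" "ground M = ground N"
    "\<And>X. X \<subseteq> ground M \<Longrightarrow> rank M X = rank N X"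
  shows "M = N"
proof -
  have "indep M X = indep N X" for X
  proof (cases "X \<subseteq> ground M")
    case True
    then have "finite X" using finite_subset[OF _ matroidD(1)[OF assms(1)]] by blast
    then show ?thesis using indep_iff_rank assms True by metis
  next
    case False
    then show ?thesis using matroidD(2) assms by metis
  qed
  then show ?thesis using assms(3) by (cases M; cases N) auto
qed

lemma rank_delete: "rank (delete M D) X = rank M (X \<inter> (ground M - D))"
proof -
  have "{card I | I. I \<subseteq> X \<and> indep (delete M D) I}
      = {card I | I. I \<subseteq> X \<inter> (ground M - D) \<and> indep M I}"
    unfolding delete_def by (simp add: conj_ac)
  then show ?thesis unfolding rank_def by simp
qed

lemma rank_delete_sub: "X \<subseteq> ground M - D \<Longrightarrow> rank (delete M D) X = rank M X"
  by (simp add: rank_delete Int_absorb2)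

lemma rank_dual:
  assumes M: "matroid M" and X: "X \<subseteq> ground M"
  shows "rank (dual M) X + rank M (ground M) = card X + rank M (ground M - X)"
proof -
  note fin = matroidD(1)[OF M]
  have fX: "finite X" using X fin finite_subset by blast
  have le: "rank (dual M) X + rank M (ground M) \<le> card X + rank M (ground M - X)"
  proof -
    obtain I where I: "indep (dual M) I" "I \<subseteq> X" "card I = rank (dual M) X"
      by (rule rank_obtain[OF matroid_dual[OF M]])
    then obtain B where B: "base M B" "I \<subseteq> ground M - B" by (auto simp: dual_def)
    then have iB: "indep M B" "card B = rank M (ground M)" using base_iff_rank[OF M] by auto
    have fB: "finite B" using indep_finite[OF M iB(1)] .
    have "card (B - X) \<le> rank M (ground M - X)"
      using matroidD(2)[OF M iB(1)] matroidD(4)[OF M iB(1), of "B - X"]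
      by (intro card_le_rank[OF M]) auto
    moreover have "card B = card (B - X) + card (B \<inter> X)" using fB by (metis add.commute card_Int_Diff)
    moreover have "card I + card (B \<inter> X) \<le> card X"
    proof -
      have "card (I \<union> (B \<inter> X)) \<le> card X" using I fX by (intro card_mono) auto
      moreover have "card (I \<union> (B \<inter> X)) = card I + card (B \<inter> X)"
        using B(2) I fX fB finite_subset by (intro card_Un_disjoint) auto
      ultimately show ?thesis by simp
    qed
    ultimately show ?thesis using I iB by linarith
  qed
  have ge: "card X + rank M (ground M - X) \<le> rank (dual M) X + rank M (ground M)"
  proof -
    obtain I where I: "indep M I" "I \<subseteq> ground M - X" "card I = rank M (ground M - X)"
      by (rule rank_obtain[OF M])
    obtain B where B: "indep M B" "I \<subseteq> B" "B \<subseteq> ground M" "card B = rank M (ground M)"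
      using rank_extend[OF M I(1), of "ground M"] I(2) by blast
    have fB: "finite B" using indep_finite[OF M B(1)] .
    have "indep (dual M) (X - B)"
      using X B base_iff_rank[OF M] unfolding dual_def by (auto intro!: exI[of _ B])
    then have "card (X - B) \<le> rank (dual M) X" by (intro card_le_rank[OF matroid_dual[OF M]]) auto
    moreover have "card X = card (X - B) + card (X \<inter> B)" using fX by (metis add.commute card_Int_Diff)
    moreover have "card I + card (X \<inter> B) \<le> card B"
    proof -
      have "card (I \<union> (X \<inter> B)) \<le> card B" using I B fB by (intro card_mono) auto
      moreover have "card (I \<union> (X \<inter> B)) = card I + card (X \<inter> B)"
        using I fX finite_subset[OF B(2) fB] by (intro card_Un_disjoint) auto
      ultimately show ?thesis by simp
    qed
    ultimately show ?thesis using I B by linarith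
  qed
  show ?thesis using le ge by simp
qed

lemma card_Diff_add:
  assumes "finite E" "X \<subseteq> E"
  shows "card (E - X) + card X = card E"
  by (metis assms card_Diff_subset card_mono finite_subset le_add_diff_inverse2)

lemma dual_dual:
  assumes M: "matroid M" shows "dual (dual M) = M"
proof (rule matroid_eqI)
  show "matroid (dual (dual M))" "matroid M" using M matroid_dual by blast+
  fix X assume "X \<subseteq> ground (dual (dual M))"
  then have X: "X \<subseteq> ground M" by simp
  have fX: "card (ground M - X) + card X = card (ground M)"
    by (rule card_Diff_add[OF matroidD(1)[OF M] X])
  have "rank M (ground M - ground M) = 0" using M by simp
  then show "rank (dual (dual M)) X = rank M X"
    using rank_dual[OF M, of "ground M - X"] rank_dual[OF M, of "ground M"]
      rank_dual[OF matroid_dual[OF M], of X] X fX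
    by (simp add: double_diff)
qed simp

lemma rank_contract:
  assumes M: "matroid M" and C: "C \<subseteq> ground M" and X: "X \<subseteq> ground M - C"
  shows "rank (contract M C) X + rank M C = rank M (X \<union> C)"
proof -
  let ?D = "delete (dual M) C"
  have mD: "matroid ?D" using M by (intro matroid_delete matroid_dual)
  have f: "finite (ground M)" using matroidD(1)[OF M] .
  have 1: "rank (contract M C) X + rank (dual M) (ground M - C) = card X + rank (dual M) (ground M - C - X)"
    using rank_dual[OF mD, of X] X by (simp add: contract_def rank_delete_sub)
  have 2: "rank (dual M) (ground M - C) + rank M (ground M) = card (ground M - C) + rank M C"
    using rank_dual[OF M, of "ground M - C"] C by (simp add: double_diff)
  have e: "ground M - (ground M - C - X) = X \<union> C" using X C by blast
  have 3: "rank (dual M) (ground M - C - X) + rank M (ground M) = card (ground M - C - X) + rank M (X \<union> C)"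
    using rank_dual[OF M, of "ground M - C - X"] unfolding e by blast
  have 4: "card (ground M - C) = card X + card (ground M - C - X)"
    using card_Diff_add[OF finite_Diff[OF f] X] by simp
  show ?thesis using 1 2 3 4 by linarith
qed

section \<open>Minors\<close>

abbreviation remove :: "'a indep_system \<Rightarrow> 'a set \<Rightarrow> 'a set \<Rightarrow> 'a indep_system" where
  "remove M C D \<equiv> delete (contract M C) D"

lemma matroid_remove: "matroid M \<Longrightarrow> matroid (remove M C D)"
  by (intro matroid_delete matroid_contract)

lemma rank_remove:
  assumes "matroid M" "C \<subseteq> ground M" "X \<subseteq> ground M - C - D"
  shows "rank (remove M C D) X + rank M C = rank M (X \<union> C)"
  using rank_contract[of M C X] assms by (subst rank_delete_sub) auto

lemma remove_remove:
  assumes M: "matroid M" and C: "C \<union> C' \<subseteq> ground M" and d: "C \<inter> C' = {}" "D \<inter> C' = {}"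
  shows "remove (remove M C D) C' D' = remove M (C \<union> C') (D \<union> D')"
proof (rule matroid_eqI)
  show "matroid (remove (remove M C D) C' D')" "matroid (remove M (C \<union> C') (D \<union> D'))"
    by (intro matroid_remove M)+
  fix X assume X: "X \<subseteq> ground (remove (remove M C D) C' D')"
  have "rank (remove M C D) (X \<union> C') + rank M C = rank M (X \<union> C' \<union> C)"
    by (rule rank_remove) (use M C X d in auto)
  moreover have "rank (remove M C D) C' + rank M C = rank M (C' \<union> C)"
    by (rule rank_remove) (use M C X d in auto)
  moreover have "rank (remove (remove M C D) C' D') X + rank (remove M C D) C' = rank (remove M C D) (X \<union> C')"
    by (rule rank_remove[OF matroid_remove[OF M]]) (use C X d in auto)
  moreover have "rank (remove M (C \<union> C') (D \<union> D')) X + rank M (C \<union> C') = rank M (X \<union> (C \<union> C'))"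
    by (rule rank_remove[OF M]) (use C X d in auto)
  moreover have "X \<union> C' \<union> C = X \<union> (C \<union> C')" "C' \<union> C = C \<union> C'" by auto
  ultimately show "rank (remove (remove M C D) C' D') X = rank (remove M (C \<union> C') (D \<union> D')) X"
    by (simp only:)
qed auto

lemma delete_empty [simp]: "matroid M \<Longrightarrow> delete M {} = M"
  by (intro matroid_eqI matroid_delete) (auto simp: rank_delete_sub)

lemma contract_empty [simp]: "matroid M \<Longrightarrow> contract M {} = M"
  unfolding contract_def by (simp add: matroid_dual dual_dual)

lemma dual_delete: "matroid M \<Longrightarrow> dual (delete M D) = contract (dual M) D"
  by (simp add: contract_def dual_dual)

lemma dual_contract: "matroid M \<Longrightarrow> dual (contract M C) = delete (dual M) C"
  by (simp add: contract_def dual_dual matroid_dual matroid_delete)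

lemma contract_delete:
  assumes "matroid M" "C \<subseteq> ground M" "C \<inter> D = {}"
  shows "contract (delete M D) C = remove M C D"
  using remove_remove[of M "{}" C D "{}"] assms
  by (simp add: Int_commute matroid_remove matroid_contract matroid_delete)

lemma dual_remove:
  assumes "matroid M" "D \<subseteq> ground M" "C \<inter> D = {}"
  shows "dual (remove M C D) = remove (dual M) D C"
  using assms contract_delete[of "dual M" D C]
  by (simp add: dual_delete matroid_contract dual_contract matroid_dual Int_commute)

lemma minorI: "C \<subseteq> ground M \<Longrightarrow> D \<subseteq> ground M \<Longrightarrow> C \<inter> D = {} \<Longrightarrow> minor (remove M C D) M"
  unfolding minor_def by blast

lemma connectivity_dual:
  assumes M: "matroid M" and X: "X \<subseteq> ground M"
  shows "connectivity (dual M) X = connectivity M X"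
proof -
  have "card (ground M - X) + card X = card (ground M)"
    by (rule card_Diff_add[OF matroidD(1)[OF M] X])
  moreover have "rank M (ground M - ground M) = 0" using M by simp
  ultimately show ?thesis
    using rank_dual[OF M X] rank_dual[OF M, of "ground M - X"] rank_dual[OF M, of "ground M"] X
    by (simp add: connectivity_def double_diff)
qed

lemma connectivity_remove:
  assumes M: "matroid M" and C: "C \<subseteq> ground M" and d: "C \<inter> D = {}" and X: "X \<subseteq> ground M - C - D"
  shows "connectivity (remove M C D) X =
    int (rank M (X \<union> C)) + int (rank M (ground M - D - X)) - int (rank M (ground M - D)) - int (rank M C)"
proof -
  have e: "ground M - C - D - X \<union> C = ground M - D - X" "ground M - C - D \<union> C = ground M - D"
    using C d X by auto
  show ?thesis
    using rank_remove[OF M C X] rank_remove[OF M C, of "ground M - C - D - X" D]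
      rank_remove[OF M C, of "ground M - C - D" D] 
    unfolding connectivity_def by (simp add: e)
qed

lemma connectivity_delete_le:
  assumes M: "matroid M" and X: "X \<subseteq> ground M"
  shows "connectivity (delete M D) (X - D) \<le> connectivity M X"
proof -
  have "rank M (X - D) + rank M (X \<union> (ground M - D)) \<le> rank M X + rank M (ground M - D)"
    by (rule rank_submod'[OF M]) (use X in auto)
  moreover have "rank M (ground M - D - X) + rank M (ground M)
      \<le> rank M (X \<union> (ground M - D)) + rank M (ground M - X)"
    by (rule rank_submod'[OF M]) (use X in auto)
  moreover have "ground M - D - (X - D) = ground M - D - X" by blast
  ultimately show ?thesis using X unfolding connectivity_def
    by (simp add: rank_delete_sub[of "X - D"] rank_delete_sub[of "ground M - D"] 
        rank_delete_sub[of "ground M - D - X"] Diff_mono)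
qed

lemma connectivity_contract_le:
  assumes M: "matroid M" and X: "X \<subseteq> ground M"
  shows "connectivity (contract M C) (X - C) \<le> connectivity M X"
proof -
  have "connectivity (contract M C) (X - C) = connectivity (delete (dual M) C) (X - C)"
    unfolding contract_def
    by (rule connectivity_dual) (use M X in \<open>auto intro: matroid_delete matroid_dual\<close>)
  also have "\<dots> \<le> connectivity (dual M) X"
    by (rule connectivity_delete_le) (use M X in \<open>auto intro: matroid_dual\<close>)
  finally show ?thesis using connectivity_dual[OF M X] by simp
qed

lemma connectivity_remove_mono:
  assumes M: "matroid M" and CD: "C \<subseteq> ground M" "C \<inter> D = {}" and sub: "C' \<subseteq> C" "D' \<subseteq> D"
    and X: "X \<subseteq> ground M - C' - D'" and Y: "Y = X - C - D"
  shows "connectivity (remove M C D) Y \<le> connectivity (remove M C' D') X"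
proof -
  have e: "C' \<union> (C - C') = C" "D' \<union> (D - D') = D" using sub by auto
  have "remove (remove M C' D') (C - C') (D - D') = remove M (C' \<union> (C - C')) (D' \<union> (D - D'))"
    by (rule remove_remove) (use M CD sub in auto)
  then have eq: "remove M C D = remove (remove M C' D') (C - C') (D - D')" by (simp only: e)
  have Y': "Y = X - (C - C') - (D - D')" using X Y by auto
  have "connectivity (remove (remove M C' D') (C - C') (D - D')) (X - (C - C') - (D - D'))
      \<le> connectivity (contract (remove M C' D') (C - C')) (X - (C - C'))"
    by (rule connectivity_delete_le) (use M X in \<open>auto intro: matroid_contract matroid_remove\<close>)
  also have "\<dots> \<le> connectivity (remove M C' D') X"
    by (rule connectivity_contract_le) (use M X in \<open>auto intro: matroid_remove\<close>)
  finally show ?thesis unfolding eq Y' .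
qed

lemma circuit_subset:
  assumes M: "matroid M" and X: "X \<subseteq> ground M" "\<not> indep M X"
  obtains K where "circuit M K" "K \<subseteq> X"
proof -
  let ?P = "\<lambda>K. K \<subseteq> X \<and> \<not> indep M K"
  have "?P X" using X(2) by simp
  then obtain K where K: "?P K" and min: "\<forall>J. ?P J \<longrightarrow> card K \<le> card J"
    using ex_has_least_nat[of ?P X card] by meson
  have fK: "finite K"
    using K X(1) matroidD(1)[OF M] by (meson finite_subset)
  have "indep M J" if J: "J \<subset> K" for J
  proof (rule ccontr)
    assume "\<not> indep M J"
    then have "card K \<le> card J" using min J K by (meson psubset_imp_subset subset_trans)
    then show False using psubset_card_mono[OF fK J] by simp
  qed
  then have "circuit M K" unfolding circuit_def using K X(1) by (meson subset_trans)
  moreover have "K \<subseteq> X" using K by simp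
  ultimately show ?thesis by (rule that)
qed

lemma simple_matroid_iff:
  assumes M: "matroid M"
  shows "simple_matroid M \<longleftrightarrow> (\<forall>x\<in>ground M. \<forall>y\<in>ground M. indep M {x, y})"
proof
  assume s: "simple_matroid M"
  show "\<forall>x\<in>ground M. \<forall>y\<in>ground M. indep M {x, y}"
  proof (intro ballI, rule ccontr)
    fix x y assume "x \<in> ground M" "y \<in> ground M" "\<not> indep M {x, y}"
    then obtain K where K: "circuit M K" "K \<subseteq> {x, y}" using circuit_subset[OF M, of "{x, y}"] by blast
    then consider "K = {}" | z where "K = {z}" | "x \<noteq> y" "K = {x, y}" by blast
    then show False
    proof cases
      case 1
      then show False using K(1) matroidD(3)[OF M] by (simp add: circuit_def)
    next
      case 2
      then show False using K(1) s by (simp add: simple_matroid_def)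
    next
      case 3
      then show False using K(1) s by (simp add: simple_matroid_def)
    qed
  qed
next
  assume i: "\<forall>x\<in>ground M. \<forall>y\<in>ground M. indep M {x, y}"
  have "indep M {x}" if "x \<in> ground M" for x using i that by force
  then show "simple_matroid M" using i by (auto simp: simple_matroid_def circuit_def)
qed

lemma cosimple_iff_dual: "cosimple_matroid M \<longleftrightarrow> simple_matroid (dual M)"
  by (simp add: cosimple_matroid_def simple_matroid_def)

section \<open>Relabelling\<close>

definition relabel :: "('a \<Rightarrow> 'a) \<Rightarrow> 'a indep_system \<Rightarrow> 'a indep_system" where
  "relabel \<pi> M = \<lparr>ground = \<pi> ` ground M, indep = (\<lambda>I. indep M (\<pi> -` I))\<rparr>"

context
  fixes \<pi> :: "'a \<Rightarrow> 'a"
  assumes bij: "bij \<pi>"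
begin

lemma inj_relabel: "inj \<pi>" and surj_relabel [simp]: "surj \<pi>"
  using bij by (simp_all add: bij_is_inj bij_is_surj)

lemma vimage_image [simp]: "\<pi> -` (\<pi> ` X) = X"
  by (simp add: inj_relabel inj_vimage_image_eq)

lemma image_vimage [simp]: "\<pi> ` (\<pi> -` X) = X"
  by (simp add: surj_relabel image_vimage_eq)

lemma all_image: "(\<forall>X. P X) \<longleftrightarrow> (\<forall>X. P (\<pi> ` X))"
  by (metis image_vimage)

lemma ex_image: "(\<exists>X. P X) \<longleftrightarrow> (\<exists>X. P (\<pi> ` X))"
  by (metis image_vimage)

lemma image_Diff: "\<pi> ` X - \<pi> ` Y = \<pi> ` (X - Y)"
  by (simp add: inj_relabel image_set_diff)

lemma image_sub [simp]: "\<pi> ` X \<subseteq> \<pi> ` Y \<longleftrightarrow> X \<subseteq> Y"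
  by (simp add: inj_relabel inj_image_subset_iff)

lemma image_psub [simp]: "\<pi> ` X \<subset> \<pi> ` Y \<longleftrightarrow> X \<subset> Y"
  by (simp add: psubset_eq inj_relabel inj_image_eq_iff)

lemma image_eq [simp]: "\<pi> ` X = \<pi> ` Y \<longleftrightarrow> X = Y"
  by (simp add: inj_relabel inj_image_eq_iff)

lemma card_relabel [simp]: "card (\<pi> ` X) = card X"
  by (meson card_image inj_on_subset inj_relabel subset_UNIV)

lemma finite_relabel [simp]: "finite (\<pi> ` X) \<longleftrightarrow> finite X"
  by (meson finite_image_iff inj_on_subset inj_relabel subset_UNIV)

lemma ground_relabel [simp]: "ground (relabel \<pi> M) = \<pi> ` ground M"
  by (simp add: relabel_def)

lemma indep_relabel [simp]: "indep (relabel \<pi> M) (\<pi> ` X) \<longleftrightarrow> indep M X"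
  by (simp add: relabel_def)

lemma indep_system_eqI:
  assumes "ground M = ground N" "\<And>X. indep M X \<longleftrightarrow> indep N X"
  shows "M = (N :: 'a indep_system)"
  using assms by (cases M; cases N) auto

lemma relabel_eqI:
  assumes "ground M = \<pi> ` ground N" "\<And>X. indep M (\<pi> ` X) \<longleftrightarrow> indep N X"
  shows "M = relabel \<pi> N"
proof (rule indep_system_eqI)
  fix X
  show "indep M X = indep (relabel \<pi> N) X"
    using assms(2)[of "\<pi> -` X"] by (simp add: relabel_def)
qed (use assms(1) in simp)

lemma matroid_relabel: 
  assumes M: "matroid M" shows "matroid (relabel \<pi> M)"
proof (rule matroidI)
  let ?R = "relabel \<pi> M"
  show "finite (ground ?R)" using matroidD(1)[OF M] by simp
  show "indep ?R {}" using matroidD(3)[OF M] by (simp add: relabel_def)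
  show "I \<subseteq> ground ?R" if "indep ?R I" for I
  proof -
    have "\<pi> -` I \<subseteq> ground M" using that matroidD(2)[OF M] by (simp add: relabel_def)
    then have "\<pi> ` (\<pi> -` I) \<subseteq> \<pi> ` ground M" by (rule image_mono)
    then show ?thesis by simp
  qed
  show "indep ?R I" if "indep ?R J" "I \<subseteq> J" for I J
    using matroidD(4)[OF M, of "\<pi> -` J" "\<pi> -` I"] that vimage_mono[of I J \<pi>] by (simp add: relabel_def)
  show "\<exists>x\<in>J - I. indep ?R (insert x I)" if h: "indep ?R I" "indep ?R J" "card I < card J" for I J
  proof -
    have c: "card (\<pi> -` X) = card X" for X using card_relabel[of "\<pi> -` X"] by simp
    obtain x where x: "x \<in> \<pi> -` J - \<pi> -` I" "indep M (insert x (\<pi> -` I))"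
      using matroidD(5)[OF M, of "\<pi> -` I" "\<pi> -` J"] h unfolding c by (auto simp: relabel_def)
    have "\<pi> -` insert (\<pi> x) I = insert x (\<pi> -` I)" using inj_relabel by (auto dest: injD)
    then show ?thesis using x by (intro bexI[of _ "\<pi> x"]) (auto simp: relabel_def)
  qed
qed

lemma base_relabel [simp]: "base (relabel \<pi> M) (\<pi> ` X) \<longleftrightarrow> base M X"
  unfolding base_def by (subst all_image) simp

lemma dual_relabel: "dual (relabel \<pi> M) = relabel \<pi> (dual M)"
proof (rule relabel_eqI)
  fix X show "indep (dual (relabel \<pi> M)) (\<pi> ` X) = indep (dual M) X"
    unfolding dual_def by (simp, subst ex_image) (simp add: image_Diff)
qed simp

lemma delete_relabel: "delete (relabel \<pi> M) (\<pi> ` D) = relabel \<pi> (delete M D)"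
  by (rule relabel_eqI) (simp_all add: delete_def image_Diff)

lemma contract_relabel: "contract (relabel \<pi> M) (\<pi> ` C) = relabel \<pi> (contract M C)"
  by (simp add: contract_def dual_relabel delete_relabel)

lemma circuit_relabel [simp]: "circuit (relabel \<pi> M) (\<pi> ` X) \<longleftrightarrow> circuit M X"
  unfolding circuit_def by (subst all_image) simp

lemma rank_relabel [simp]: "rank (relabel \<pi> M) (\<pi> ` X) = rank M X"
proof -
  have "{card I | I. I \<subseteq> \<pi> ` X \<and> indep (relabel \<pi> M) I} = {card I | I. I \<subseteq> X \<and> indep M I}"
    by (intro Collect_cong, subst ex_image) simp
  then show ?thesis by (simp add: rank_def)
qed

lemma connectivity_relabel [simp]:
  "connectivity (relabel \<pi> M) (\<pi> ` X) = connectivity M X"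
  by (simp add: connectivity_def image_Diff)

lemma matroid_iso_relabel: "matroid_iso \<pi> M (relabel \<pi> M)"
  using inj_relabel by (auto simp: matroid_iso_def bij_betw_def inj_on_def dest: injD)

lemma simple_relabel:
  assumes "matroid M"
  shows "simple_matroid (relabel \<pi> M) \<longleftrightarrow> simple_matroid M"
proof -
  have "indep (relabel \<pi> M) {\<pi> x, \<pi> y} \<longleftrightarrow> indep M {x, y}" for x y
    using indep_relabel[of M "{x, y}"] by simp
  then show ?thesis by (simp add: simple_matroid_iff matroid_relabel assms)
qed

lemma cosimple_relabel:
  "matroid M \<Longrightarrow> cosimple_matroid (relabel \<pi> M) \<longleftrightarrow> cosimple_matroid M"
  by (simp add: cosimple_iff_dual dual_relabel simple_relabel matroid_dual)

lemma relabel_inv: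
  assumes "N = relabel \<pi> M" shows "relabel (inv \<pi>) N = M"
proof (rule indep_system_eqI)
  have v: "inv \<pi> -` X = \<pi> ` X" for X using bij by (simp add: bij_vimage_eq_inv_image bij_imp_bij_inv inv_inv_eq)
  fix X show "indep (relabel (inv \<pi>) N) X = indep M X"
    unfolding assms by (subst relabel_def) (simp add: v)
  show "ground (relabel (inv \<pi>) N) = ground M"
    unfolding assms relabel_def by (simp add: image_inv_f_f inj_relabel)
qed

end

lemma relabel_relabel_inv: "bij \<pi> \<Longrightarrow> relabel \<pi> (relabel (inv \<pi>) M) = M"
  using relabel_inv[of "inv \<pi>" "relabel (inv \<pi>) M" M] by (simp add: bij_imp_bij_inv inv_inv_eq)

lemma extend_to_bij:
  fixes S T :: "'a set"
  assumes fin: "finite S" "finite T" and f: "bij_betw f S T"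
  obtains \<pi> where "bij \<pi>" "\<And>x. x \<in> S \<Longrightarrow> \<pi> x = f x"
proof -
  have c: "card S = card T" by (rule bij_betw_same_card[OF f])
  have "card (T - S) = card (S - T)"
    using c fin by (metis card_Diff_subset_Int Int_commute finite_Int)
  then obtain g where g: "bij_betw g (T - S) (S - T)"
    using fin by (meson finite_Diff finite_same_card_bij)
  let ?h = "\<lambda>x. if x \<in> S then f x else g x"
  have "bij_betw ?h (S \<union> (T - S)) (T \<union> (S - T))"
    by (rule bij_betw_disjoint_Un) (use f g in auto)
  then have "bij_betw ?h (S \<union> T) (S \<union> T)" by (simp add: Un_commute)
  moreover have "bij_betw id (- (S \<union> T)) (- (S \<union> T))" by simp
  ultimately have "bij_betw (\<lambda>x. if x \<in> S \<union> T then ?h x else id x)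
      ((S \<union> T) \<union> - (S \<union> T)) ((S \<union> T) \<union> - (S \<union> T))"
    by (rule bij_betw_disjoint_Un) auto
  then have "bij (\<lambda>x. if x \<in> S \<union> T then ?h x else id x)" by (simp only: Compl_partition)
  then show ?thesis by (rule that) simp
qed

section \<open>The hypotheses on a class of matroids\<close>

text \<open>The hypotheses are weakened to a form that is invariant under duality and relabelling: of
  the two ways to reach a two-element enlargement in (iii), each only yields what the proof needs.\<close>

locale decomposer_hypotheses =
  fixes \<M> :: "'a indep_system set" and k :: nat and N :: "'a indep_system" and A B :: "'a set"
  assumes matroid_class: "\<And>M. M \<in> \<M> \<Longrightarrow> matroid M"
    and minor_class: "\<And>M M'. M \<in> \<M> \<Longrightarrow> minor M' M \<Longrightarrow> M' \<in> \<M>"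
    and relabel_class: "\<And>M \<pi>. M \<in> \<M> \<Longrightarrow> bij \<pi> \<Longrightarrow> relabel \<pi> M \<in> \<M>"
    and N_in: "N \<in> \<M>"
    and simple_N: "simple_matroid N"
    and cosimple_N: "cosimple_matroid N"
    and ground_N: "ground N = A \<union> B" "A \<inter> B = {}"
    and conn_N: "connectivity N A = int k - 1"
    and no_coloop: "\<And>a. a \<in> A \<Longrightarrow> rank N (A - {a}) = rank N A"
    and no_loop: "\<And>a. a \<in> A \<Longrightarrow> rank (dual N) (A - {a}) = rank (dual N) A"
    and ext: "\<And>M e. \<lbrakk>M \<in> \<M>; simple_extension M e N\<rbrakk> \<Longrightarrow>
          connectivity M A = int k - 1 \<or> connectivity M (A \<union> {e}) = int k - 1"
    and coext: "\<And>M f. \<lbrakk>M \<in> \<M>; cosimple_coextension M f N\<rbrakk> \<Longrightarrow>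
          connectivity M A = int k - 1 \<or> connectivity M (A \<union> {f}) = int k - 1"
    and coext_ext: "\<And>M e f N'. \<lbrakk>M \<in> \<M>; cosimple_coextension M f N'; simple_extension N' e N\<rbrakk> \<Longrightarrow>
          connectivity (contract M {f}) A = int k - 1 \<or> connectivity M (A \<union> {e}) = int k - 1 \<or>
          (\<exists>g\<in>A. triad M {e, f, g} \<or> triangle M {e, f, g})"
    and ext_coext: "\<And>M e f N'. \<lbrakk>M \<in> \<M>; simple_extension M e N'; cosimple_coextension N' f N\<rbrakk> \<Longrightarrow>
          connectivity (delete M {e}) A = int k - 1 \<or> connectivity M (A \<union> {f}) = int k - 1 \<or>
          (\<exists>g\<in>A. triad M {e, f, g} \<or> triangle M {e, f, g})"
begin

lemma matroid_N: "matroid N"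
  by (rule matroid_class[OF N_in])

lemma sub_N: "A \<subseteq> ground N" "B \<subseteq> ground N"
  by (simp_all add: ground_N)

lemma simple_extension_dual:
  assumes "M \<in> \<M>" "matroid N'" "simple_extension (dual M) e (dual N')"
  shows "cosimple_coextension M e N'"
  using assms dual_delete[of "dual M" "{e}"] matroid_class[OF assms(1)]
  by (auto simp: simple_extension_def cosimple_coextension_def cosimple_iff_dual dual_dual matroid_dual)

lemma cosimple_coextension_dual:
  assumes "M \<in> \<M>" "matroid N'" "cosimple_coextension (dual M) f (dual N')"
  shows "simple_extension M f N'"
  using assms dual_contract[of "dual M" "{f}"] matroid_class[OF assms(1)]
  by (auto simp: simple_extension_def cosimple_coextension_def cosimple_iff_dual dual_dual matroid_dual)

lemma hypotheses_dual: "decomposer_hypotheses (dual ` \<M>) k (dual N) A B"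
proof
  note dd = dual_dual[OF matroid_class]
  fix M assume "M \<in> dual ` \<M>"
  then obtain M0 where M0: "M0 \<in> \<M>" "M = dual M0" by (elim imageE)
  then have M: "matroid M0" "matroid M" "dual M = M0" by (simp_all add: matroid_class matroid_dual dd)
  show "matroid M" by (rule M)
  show "relabel \<pi> M \<in> dual ` \<M>" if p: "bij \<pi>" for \<pi>
  proof -
    have "relabel \<pi> M = dual (relabel \<pi> M0)" using dual_relabel[OF p, of M0] M0(2) by simp
    then show ?thesis using relabel_class[OF M0(1) p] by (rule image_eqI)
  qed
  show "M' \<in> dual ` \<M>" if minor: "minor M' M" for M'
  proof -
    obtain C D where CD: "C \<subseteq> ground M" "D \<subseteq> ground M" "C \<inter> D = {}" "M' = remove M C D"
      using minor unfolding minor_def by blast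
    have "dual M' = remove M0 D C" using dual_remove[OF M(2) CD(2,3)] CD(4) M(3) by simp
    moreover have "minor (remove M0 D C) M0" using CD M0(2) by (intro minorI) auto
    ultimately have "dual M' \<in> \<M>" using minor_class M0(1) by simp
    moreover have "M' = dual (dual M')" using CD(4) M(2) by (simp add: dual_dual matroid_remove)
    ultimately show ?thesis by blast
  qed
  have c: "connectivity M X = connectivity M0 X" if "X \<subseteq> ground M0" for X
    using connectivity_dual[OF M(1) that] M0(2) by simp
  show "connectivity M A = int k - 1 \<or> connectivity M (A \<union> {e}) = int k - 1"
    if "simple_extension M e (dual N)" for e
  proof -
    have "cosimple_coextension M0 e N"
      by (rule simple_extension_dual) (use that M0 matroid_N in auto)
    moreover from this have "A \<subseteq> ground M0" "A \<union> {e} \<subseteq> ground M0"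
      using ground_N by (auto simp: cosimple_coextension_def)
    ultimately show ?thesis using coext[OF M0(1)] c by simp
  qed
  show "connectivity M A = int k - 1 \<or> connectivity M (A \<union> {f}) = int k - 1"
    if "cosimple_coextension M f (dual N)" for f
  proof -
    have "simple_extension M0 f N"
      by (rule cosimple_coextension_dual) (use that M0 matroid_N in auto)
    moreover from this have "A \<subseteq> ground M0" "A \<union> {f} \<subseteq> ground M0"
      using ground_N by (auto simp: simple_extension_def)
    ultimately show ?thesis using ext[OF M0(1)] c by simp
  qed
  have t: "triad M X \<longleftrightarrow> triangle M0 X" "triangle M X \<longleftrightarrow> triad M0 X" for X
    unfolding triad_def triangle_def M(3) using M0(2) by auto
  show "connectivity (contract M {f}) A = int k - 1 \<or> connectivity M (A \<union> {e}) = int k - 1 \<or>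
          (\<exists>g\<in>A. triad M {e, f, g} \<or> triangle M {e, f, g})"
    if "cosimple_coextension M f N'" "simple_extension N' e (dual N)" for e f N'
  proof -
    have N': "N' = dual (delete M0 {f})" 
      using that(1) M(1) M0(2) by (simp add: cosimple_coextension_def dual_delete)
    have D: "delete M0 {f} \<in> \<M>"
      using minor_class[OF M0(1)] minorI[of "{}" M0 "{f}"] M(1) that(1) M0(2)
      by (simp add: cosimple_coextension_def)
    have 1: "simple_extension M0 f (delete M0 {f})"
      by (rule cosimple_coextension_dual) (use that M0 D N' matroid_class in auto)
    have 2: "cosimple_coextension (delete M0 {f}) e N"
      by (rule simple_extension_dual) (use that D N' matroid_N in auto)
    have g: "A \<subseteq> ground (delete M0 {f})" "A \<union> {e} \<subseteq> ground M0"
      using 1 2 ground_N by (auto simp: simple_extension_def cosimple_coextension_def)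
    have "contract M {f} = dual (delete M0 {f})" using M M0(2) by (simp add: dual_delete)
    then have "connectivity (contract M {f}) A = connectivity (delete M0 {f}) A"
      using connectivity_dual[OF matroid_class[OF D] g(1)] by simp
    then show ?thesis using ext_coext[OF M0(1) 1 2] c[OF g(2)] by (auto simp: t insert_commute)
  qed
  show "connectivity (delete M {e}) A = int k - 1 \<or> connectivity M (A \<union> {f}) = int k - 1 \<or>
          (\<exists>g\<in>A. triad M {e, f, g} \<or> triangle M {e, f, g})"
    if "simple_extension M e N'" "cosimple_coextension N' f (dual N)" for e f N'
  proof -
    have N': "N' = dual (contract M0 {e})" 
      using that(1) M(1) M0(2) by (simp add: simple_extension_def dual_contract)
    have D: "contract M0 {e} \<in> \<M>"
      using minor_class[OF M0(1)] minorI[of "{e}" M0 "{}"] M(1) that(1) M0(2)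
      by (simp add: simple_extension_def matroid_contract)
    have 1: "cosimple_coextension M0 e (contract M0 {e})"
      by (rule simple_extension_dual) (use that M0 D N' matroid_class in auto)
    have 2: "simple_extension (contract M0 {e}) f N"
      by (rule cosimple_coextension_dual) (use that D N' matroid_N in auto)
    have g: "A \<subseteq> ground (contract M0 {e})" "A \<union> {f} \<subseteq> ground M0"
      using 1 2 ground_N by (auto simp: simple_extension_def cosimple_coextension_def)
    have "delete M {e} = dual (contract M0 {e})" using M M0(2) by (simp add: dual_contract)
    then have "connectivity (delete M {e}) A = connectivity (contract M0 {e}) A"
      using connectivity_dual[OF matroid_class[OF D] g(1)] by simp
    then show ?thesis using coext_ext[OF M0(1) 1 2] c[OF g(2)] by (auto simp: t insert_commute)
  qed
next
  show "dual N \<in> dual ` \<M>" using N_in by simp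
  show "simple_matroid (dual N)" "cosimple_matroid (dual N)"
    using simple_N cosimple_N by (simp_all add: cosimple_iff_dual dual_dual matroid_N)
  show "ground (dual N) = A \<union> B" "A \<inter> B = {}" using ground_N by auto
  show "connectivity (dual N) A = int k - 1"
    using conn_N connectivity_dual[OF matroid_N sub_N(1)] by simp
  show "rank (dual N) (A - {a}) = rank (dual N) A"
    "rank (dual (dual N)) (A - {a}) = rank (dual (dual N)) A" if "a \<in> A" for a
    using no_coloop no_loop that by (simp_all add: dual_dual matroid_N)
qed

lemma hypotheses_relabel:
  assumes bij: "bij \<pi>"
  shows "decomposer_hypotheses \<M> k (relabel \<pi> N) (\<pi> ` A) (\<pi> ` B)"
proof
  let ?p = "inv \<pi>"
  have bij': "bij ?p" using bij by (rule bij_imp_bij_inv)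
  note r = relabel_relabel_inv[OF bij]
  fix M assume M: "M \<in> \<M>"
  define M0 where "M0 = relabel ?p M"
  have M0: "M0 \<in> \<M>" "M = relabel \<pi> M0" "matroid M0"
    unfolding M0_def using M relabel_class bij' r matroid_class by auto
  show "matroid M" "\<And>M'. minor M' M \<Longrightarrow> M' \<in> \<M>" "\<And>\<pi>. bij \<pi> \<Longrightarrow> relabel \<pi> M \<in> \<M>"
    using M matroid_class minor_class relabel_class by auto
  have e: "\<pi> (?p x) = x" for x using bij by (simp add: bij_is_surj surj_f_inv_f)
  have i: "insert x (\<pi> ` X) = \<pi> ` insert (?p x) X" for x X using e by simp
  have i3: "{x, y, \<pi> z} = \<pi> ` {?p x, ?p y, z}" for x y z using e by simp
  have del: "delete (relabel \<pi> P) {x} = relabel \<pi> (delete P {?p x})"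
    "contract (relabel \<pi> P) {x} = relabel \<pi> (contract P {?p x})" for P x
    using delete_relabel[OF bij, of P "{?p x}"] contract_relabel[OF bij, of P "{?p x}"] e by simp_all
  have inj: "relabel \<pi> P = relabel \<pi> Q \<longleftrightarrow> P = Q" for P Q
    using relabel_inv[OF bij] by metis
  have g: "x \<in> ground (relabel \<pi> P) \<longleftrightarrow> ?p x \<in> ground P" for x P
    using e bij by (metis bij_is_inj ground_relabel[OF bij] inj_image_mem_iff)
  have se: "simple_extension (relabel \<pi> P) x (relabel \<pi> Q) \<longleftrightarrow> simple_extension P (?p x) Q" 
    if "matroid P" for P Q x
    unfolding simple_extension_def del inj g by (simp add: simple_relabel[OF bij that])
  have cs: "cosimple_coextension (relabel \<pi> P) x (relabel \<pi> Q) \<longleftrightarrow> cosimple_coextension P (?p x) Q" 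
    if "matroid P" for P Q x
    unfolding cosimple_coextension_def del inj g by (simp add: cosimple_relabel[OF bij that])
  have t: "triangle (relabel \<pi> P) (\<pi> ` X) \<longleftrightarrow> triangle P X" 
    "triad (relabel \<pi> P) (\<pi> ` X) \<longleftrightarrow> triad P X" for P X
    by (simp_all add: triangle_def triad_def bij dual_relabel[OF bij])
  show "connectivity M (\<pi> ` A) = int k - 1 \<or> connectivity M (\<pi> ` A \<union> {e}) = int k - 1"
    if "simple_extension M e (relabel \<pi> N)" for e
    using ext[OF M0(1), of "?p e"] that se[OF M0(3)]
    by (simp add: M0(2) i connectivity_relabel[OF bij] del: image_insert)
  show "connectivity M (\<pi> ` A) = int k - 1 \<or> connectivity M (\<pi> ` A \<union> {f}) = int k - 1"
    if "cosimple_coextension M f (relabel \<pi> N)" for f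
    using coext[OF M0(1), of "?p f"] that cs[OF M0(3)]
    by (simp add: M0(2) i connectivity_relabel[OF bij] del: image_insert)
  show "connectivity (contract M {f}) (\<pi> ` A) = int k - 1 \<or> connectivity M (\<pi> ` A \<union> {e}) = int k - 1 \<or>
          (\<exists>g\<in>\<pi> ` A. triad M {e, f, g} \<or> triangle M {e, f, g})"
    if "cosimple_coextension M f N'" "simple_extension N' e (relabel \<pi> N)" for e f N'
  proof -
    have N': "N' = relabel \<pi> (contract M0 {?p f})"
      using that(1) M0(2) del(2) by (simp add: cosimple_coextension_def)
    have "cosimple_coextension M0 (?p f) (contract M0 {?p f})" 
      using that(1) cs[OF M0(3)] N' M0(2) by simp
    moreover have "simple_extension (contract M0 {?p f}) (?p e) N"
      using that(2) se[OF matroid_contract[OF M0(3)]] N' by simp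
    ultimately show ?thesis using coext_ext[OF M0(1)]
      by (simp add: M0(2) i i3 t del connectivity_relabel[OF bij] del: image_insert)
  qed
  show "connectivity (delete M {e}) (\<pi> ` A) = int k - 1 \<or> connectivity M (\<pi> ` A \<union> {f}) = int k - 1 \<or>
          (\<exists>g\<in>\<pi> ` A. triad M {e, f, g} \<or> triangle M {e, f, g})"
    if "simple_extension M e N'" "cosimple_coextension N' f (relabel \<pi> N)" for e f N'
  proof -
    have N': "N' = relabel \<pi> (delete M0 {?p e})"
      using that(1) M0(2) del(1) by (simp add: simple_extension_def)
    have "simple_extension M0 (?p e) (delete M0 {?p e})" 
      using that(1) se[OF M0(3)] N' M0(2) by simp
    moreover have "cosimple_coextension (delete M0 {?p e}) (?p f) N"
      using that(2) cs[OF matroid_delete[OF M0(3)]] N' by simp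
    ultimately show ?thesis using ext_coext[OF M0(1)]
      by (simp add: M0(2) i i3 t del connectivity_relabel[OF bij] del: image_insert)
  qed
next
  show "relabel \<pi> N \<in> \<M>" using N_in relabel_class bij by simp
  show "simple_matroid (relabel \<pi> N)" "cosimple_matroid (relabel \<pi> N)"
    using simple_N cosimple_N by (simp_all add: simple_relabel cosimple_relabel bij matroid_N)
  show "ground (relabel \<pi> N) = \<pi> ` A \<union> \<pi> ` B" using ground_N bij by auto
  show "\<pi> ` A \<inter> \<pi> ` B = {}" using ground_N bij
    by (metis bij_is_inj image_Int image_empty)
  show "connectivity (relabel \<pi> N) (\<pi> ` A) = int k - 1" using conn_N bij by simp
  fix x assume "x \<in> \<pi> ` A"
  then obtain a where a: "a \<in> A" "x = \<pi> a" by auto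
  have "\<pi> ` A - {x} = \<pi> ` (A - {a})" using a image_Diff[OF bij, of A "{a}"] by simp
  then show "rank (relabel \<pi> N) (\<pi> ` A - {x}) = rank (relabel \<pi> N) (\<pi> ` A)"
    "rank (dual (relabel \<pi> N)) (\<pi> ` A - {x}) = rank (dual (relabel \<pi> N)) (\<pi> ` A)"
    using no_coloop no_loop a(1) by (simp_all add: bij dual_relabel)
qed

end

section \<open>The linear order of a minimal counterexample\<close>

locale sign_vectors =
  fixes Z :: "'a set" and T :: "('a \<Rightarrow> int) set"
  assumes fin_Z: "finite Z"
    and sign: "\<And>s x. s \<in> T \<Longrightarrow> x \<in> Z \<Longrightarrow> s x = -1 \<or> s x = 0 \<or> s x = 1"
    and max_T: "\<And>s t. s \<in> T \<Longrightarrow> t \<in> T \<Longrightarrow> (\<lambda>x. max (s x) (t x)) \<in> T"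
    and min_T: "\<And>s t. s \<in> T \<Longrightarrow> t \<in> T \<Longrightarrow> (\<lambda>x. min (s x) (t x)) \<in> T"
    and has_zero: "\<And>s. s \<in> T \<Longrightarrow> \<exists>x\<in>Z. s x = 0"
    and single_zero: "\<And>z. z \<in> Z \<Longrightarrow> \<exists>s\<in>T. s z = 0 \<and> (\<forall>x\<in>Z - {z}. s x \<noteq> 0)"
begin

definition cut_at :: "'a \<Rightarrow> ('a \<Rightarrow> int) \<Rightarrow> bool" where
  "cut_at z s \<longleftrightarrow> s \<in> T \<and> s z = 0 \<and> (\<forall>x\<in>Z - {z}. s x \<noteq> 0)"

lemma cut_sign: "cut_at z s \<Longrightarrow> x \<in> Z \<Longrightarrow> x \<noteq> z \<Longrightarrow> s x = -1 \<or> s x = 1"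
  using sign[of s x] by (auto simp: cut_at_def)

lemma cut_opposite:
  assumes s: "cut_at v s" and t: "cut_at w t" and vw: "v \<in> Z" "w \<in> Z" "v \<noteq> w"
  shows "s w = - t v"
proof (rule ccontr)
  assume ne: "s w \<noteq> - t v"
  have sw: "s w = -1 \<or> s w = 1" and tv: "t v = -1 \<or> t v = 1"
    using cut_sign s t vw by blast+
  have st: "s \<in> T" "t \<in> T" "s v = 0" "t w = 0" using s t by (auto simp: cut_at_def)
  have *: "(s x = -1 \<or> s x = 1) \<and> (t x = -1 \<or> t x = 1)" if "x \<in> Z" "x \<noteq> v" "x \<noteq> w" for x
    using cut_sign[OF s] cut_sign[OF t] that by blast
  consider "s w = 1" "t v = 1" | "s w = -1" "t v = -1" using ne sw tv by auto
  then show False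
  proof cases
    case 1
    obtain x where "x \<in> Z" "max (s x) (t x) = 0" using has_zero[OF max_T[OF st(1,2)]] by blast
    then show False using 1 st(3,4) *[of x] by (cases "x = v"; cases "x = w") auto
  next
    case 2
    obtain x where "x \<in> Z" "min (s x) (t x) = 0" using has_zero[OF min_T[OF st(1,2)]] by blast
    then show False using 2 st(3,4) *[of x] by (cases "x = v"; cases "x = w") auto
  qed
qed

lemma cut_ex: "z \<in> Z \<Longrightarrow> \<exists>s. cut_at z s"
  using single_zero unfolding cut_at_def by blast

lemma cut_unique:
  assumes "cut_at z s" "cut_at z t" "z \<in> Z" "x \<in> Z"
  shows "s x = t x"
proof (cases "x = z")
  case True
  then show ?thesis using assms by (simp add: cut_at_def)
next
  case False
  obtain u where "cut_at x u" using cut_ex assms(4) by blast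
  then show ?thesis using cut_opposite[OF assms(1)] cut_opposite[OF assms(2)] assms(3,4) False by simp
qed

definition pos :: "'a \<Rightarrow> nat" where
  "pos z = card {u \<in> Z. \<exists>s. cut_at z s \<and> s u = 1}"

lemma cut_trans:
  assumes s: "cut_at w s" and t: "cut_at v t" and Z: "u \<in> Z" "v \<in> Z" "w \<in> Z" and "s v = 1" "t u = 1"
  shows "s u = 1"
proof -
  have vw: "v \<noteq> w" "u \<noteq> v" using assms by (auto simp: cut_at_def)
  have tw: "t w = -1" using cut_opposite[OF s t Z(3,2)] vw assms by simp
  then have uw: "u \<noteq> w" using assms by auto
  let ?m = "\<lambda>x. max (s x) (t x)"
  have "cut_at w ?m" unfolding cut_at_def
  proof (intro conjI ballI)
    show "?m \<in> T" using s t max_T by (simp add: cut_at_def)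
    show "?m w = 0" using s tw by (simp add: cut_at_def)
    fix x assume x: "x \<in> Z - {w}"
    show "?m x \<noteq> 0" using cut_sign[OF s, of x] cut_sign[OF t, of x] x assms(6) by (cases "x = v") auto
  qed
  from cut_unique[OF s this Z(3,1)] show ?thesis using assms(7) cut_sign[OF s Z(1) uw] by auto
qed

lemma pos_less:
  assumes s: "cut_at w s" and Z: "v \<in> Z" "w \<in> Z" and sv: "s v = 1"
  shows "pos v < pos w"
  unfolding pos_def
proof (rule psubset_card_mono)
  show "finite {u \<in> Z. \<exists>s. cut_at w s \<and> s u = 1}" using fin_Z by simp
  have "v \<in> {u \<in> Z. \<exists>s. cut_at w s \<and> s u = 1}" "v \<notin> {u \<in> Z. \<exists>s. cut_at v s \<and> s u = 1}"
    using s sv Z by (auto simp: cut_at_def)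
  moreover have "{u \<in> Z. \<exists>s. cut_at v s \<and> s u = 1} \<subseteq> {u \<in> Z. \<exists>s. cut_at w s \<and> s u = 1}"
    using cut_trans[OF s _ _ Z sv] s by blast
  ultimately show "{u \<in> Z. \<exists>s. cut_at v s \<and> s u = 1} \<subset> {u \<in> Z. \<exists>s. cut_at w s \<and> s u = 1}" by blast
qed

lemma first_exists:
  assumes "Z \<noteq> {}"
  obtains v s where "v \<in> Z" "cut_at v s" "\<And>u. u \<in> Z \<Longrightarrow> u \<noteq> v \<Longrightarrow> s u = -1"
proof -
  obtain v where v: "v \<in> Z" "\<And>u. u \<in> Z \<Longrightarrow> pos v \<le> pos u"
    using ex_has_least_nat[of "\<lambda>z. z \<in> Z" _ pos] assms by (metis ex_in_conv)
  obtain s where s: "cut_at v s" using cut_ex v(1) by blast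
  have "s u = -1" if "u \<in> Z" "u \<noteq> v" for u
    using cut_sign[OF s that] pos_less[OF s that(1) v(1)] v(2)[OF that(1)] by force
  then show ?thesis using v(1) s by (rule_tac that)
qed

lemma successor_exists:
  assumes s: "cut_at v s" and v: "v \<in> Z" and u: "u \<in> Z" "s u = -1"
  obtains w t where "w \<in> Z" "w \<noteq> v" "s w = -1" "cut_at w t" "t v = 1"
    "\<And>x. x \<in> Z \<Longrightarrow> x \<noteq> v \<Longrightarrow> x \<noteq> w \<Longrightarrow> t x = s x"
proof -
  obtain w where w: "w \<in> Z" "s w = -1" "\<And>x. x \<in> Z \<Longrightarrow> s x = -1 \<Longrightarrow> pos w \<le> pos x"
    using ex_has_least_nat[of "\<lambda>z. z \<in> Z \<and> s z = -1" u pos] u by (metis (no_types, lifting))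
  have wv: "w \<noteq> v" using w(2) s by (auto simp: cut_at_def)
  obtain t where t: "cut_at w t" using cut_ex w(1) by blast
  have tv: "t v = 1" using cut_opposite[OF t s] w(1,2) v wv by simp
  have "t x = s x" if x: "x \<in> Z" "x \<noteq> v" "x \<noteq> w" for x
  proof (cases "s x = 1")
    case True
    then show ?thesis using cut_trans[OF t s x(1) v w(1) tv] by simp
  next
    case False
    then have sx: "s x = -1" using cut_sign[OF s x(1,2)] by blast
    have "t x \<noteq> 1" using pos_less[OF t x(1) w(1)] w(3)[OF x(1) sx] by force
    then show ?thesis using cut_sign[OF t x(1,3)] sx by simp
  qed
  then show ?thesis using w(1) wv w(2) t tv by (rule_tac that)
qed

end

section \<open>Minimal counterexamples\<close>

lemma connectivity_delete:
  "matroid M \<Longrightarrow> X \<subseteq> ground M - D \<Longrightarrow> connectivity (delete M D) X =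
    int (rank M X) + int (rank M (ground M - D - X)) - int (rank M (ground M - D))"
  using connectivity_remove[of M "{}" D X] by simp

lemma connectivity_contract:
  "matroid M \<Longrightarrow> C \<subseteq> ground M \<Longrightarrow> X \<subseteq> ground M - C \<Longrightarrow> connectivity (contract M C) X =
    int (rank M (X \<union> C)) + int (rank M (ground M - X)) - int (rank M (ground M)) - int (rank M C)"
  using connectivity_remove[of M C "{}" X] by (simp add: matroid_contract)

lemma minor_delete:
  assumes "matroid M" "C \<subseteq> ground M" "D \<subseteq> ground M" "C \<inter> D = {}" "z \<in> D"
  shows "minor (remove M C D) (delete M {z})"
proof -
  have "remove (remove M {} {z}) C (D - {z}) = remove M ({} \<union> C) ({z} \<union> (D - {z}))"
    by (rule remove_remove) (use assms in auto)
  moreover have "{z} \<union> (D - {z}) = D" using assms(5) by auto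
  ultimately have "remove M C D = remove (delete M {z}) C (D - {z})" using assms(1) by simp
  then show ?thesis using minorI[of C "delete M {z}" "D - {z}"] assms by auto
qed

lemma minor_contract:
  assumes "matroid M" "C \<subseteq> ground M" "D \<subseteq> ground M" "C \<inter> D = {}" "z \<in> C"
  shows "minor (remove M C D) (contract M {z})"
proof -
  have "remove (remove M {z} {}) (C - {z}) D = remove M ({z} \<union> (C - {z})) ({} \<union> D)"
    by (rule remove_remove) (use assms in auto)
  moreover have "{z} \<union> (C - {z}) = C" using assms(5) by auto
  ultimately have "remove M C D = remove (contract M {z}) (C - {z}) D" 
    using assms(1) by (simp add: matroid_contract)
  then show ?thesis using minorI[of "C - {z}" "contract M {z}" D] assms by auto
qed

lemma remove_swap_loop:
  assumes M: "matroid M" and C: "C \<subseteq> ground M" "C \<inter> D = {}" "c \<in> C"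
    and r: "rank M (insert c (C - {c})) = rank M (C - {c})"
  shows "remove M C D = remove M (C - {c}) (insert c D)"
proof (rule matroid_eqI)
  show "matroid (remove M C D)" "matroid (remove M (C - {c}) (insert c D))"
    by (intro matroid_remove M)+
  show "ground (remove M C D) = ground (remove M (C - {c}) (insert c D))" using C by auto
  fix X assume "X \<subseteq> ground (remove M C D)"
  then have X: "X \<subseteq> ground M - C - D" by simp
  then have X': "X \<subseteq> ground M - (C - {c}) - insert c D" "C - {c} \<subseteq> ground M" using C by auto
  have "rank M (insert c (X \<union> (C - {c}))) = rank M (X \<union> (C - {c}))"
    by (rule rank_insert_mono[OF M _ r]) auto
  moreover have "insert c (X \<union> (C - {c})) = X \<union> C" "insert c (C - {c}) = C" using C by auto
  ultimately show "rank (remove M C D) X = rank (remove M (C - {c}) (insert c D)) X"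
    using rank_remove[OF M C(1) X] rank_remove[OF M X'(2,1)] r by simp
qed

locale min_counterexample = decomposer_hypotheses \<M> k N A B
  for \<M> :: "'a indep_system set" and k N A B +
  fixes M :: "'a indep_system" and C D :: "'a set"
  assumes M_in: "M \<in> \<M>"
    and CD: "C \<subseteq> ground M" "D \<subseteq> ground M" "C \<inter> D = {}"
    and N_eq: "N = remove M C D"
    and not_induced: "\<And>X. A \<subseteq> X \<Longrightarrow> X \<subseteq> ground M - B \<Longrightarrow> connectivity M X \<noteq> int k - 1"
    and smaller: "\<And>(\<M>' :: 'a indep_system set) N' A' B' M'. card (ground M') < card (ground M) \<Longrightarrow>
      decomposer_hypotheses \<M>' k N' A' B' \<Longrightarrow> M' \<in> \<M>' \<Longrightarrow> minor N' M' \<Longrightarrow>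
      \<exists>X. A' \<subseteq> X \<and> X \<subseteq> ground M' - B' \<and> connectivity M' X = int k - 1"
begin

lemma matroid_M: "matroid M"
  by (rule matroid_class[OF M_in])

lemma finite_CD: "finite C" "finite D"
  using CD finite_subset matroidD(1)[OF matroid_M] by metis+

lemma ground_M: "ground M = A \<union> B \<union> C \<union> D"
  using ground_N N_eq CD by auto

lemma disjoint: "A \<inter> C = {}" "A \<inter> D = {}" "B \<inter> C = {}" "B \<inter> D = {}"
  using ground_N N_eq by auto

lemma dual_min_counterexample: "min_counterexample (dual ` \<M>) k (dual N) A B (dual M) D C"
proof -
  interpret d: decomposer_hypotheses "dual ` \<M>" k "dual N" A B by (rule hypotheses_dual)
  show ?thesis
  proof
    show "dual M \<in> dual ` \<M>" using M_in by simp
    show "D \<subseteq> ground (dual M)" "C \<subseteq> ground (dual M)" "D \<inter> C = {}" using CD by auto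
    show "dual N = remove (dual M) D C" using dual_remove[OF matroid_M CD(2,3)] N_eq by simp
    show "connectivity (dual M) X \<noteq> int k - 1" if "A \<subseteq> X" "X \<subseteq> ground (dual M) - B" for X
    proof -
      have "X \<subseteq> ground M" using that(2) by auto
      then show ?thesis using not_induced[of X] connectivity_dual[OF matroid_M, of X] that by simp
    qed
    show "\<exists>X. A' \<subseteq> X \<and> X \<subseteq> ground M' - B' \<and> connectivity M' X = int k - 1"
      if "card (ground M') < card (ground (dual M))" "decomposer_hypotheses \<M>' k N' A' B'"
        "M' \<in> \<M>'" "minor N' M'" for \<M>' :: "'a indep_system set" and N' A' B' M'
      using smaller[OF _ that(2,3,4)] that(1) by simp
  qed
qed

lemma conn_remove_ge:
  assumes "C' \<subseteq> C" "D' \<subseteq> D" "A \<subseteq> Y" "Y \<subseteq> ground M - C' - D' - B"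
  shows "int k - 1 \<le> connectivity (remove M C' D') Y"
proof -
  have "A = Y - C - D" using assms(3,4) ground_M disjoint by auto
  then have "connectivity (remove M C D) A \<le> connectivity (remove M C' D') Y"
    using connectivity_remove_mono[OF matroid_M CD(1,3) assms(1,2), of Y A] assms(4) by blast
  then show ?thesis using conn_N N_eq by simp
qed

lemma conn_M_ge: "A \<subseteq> X \<Longrightarrow> X \<subseteq> ground M - B \<Longrightarrow> int k \<le> connectivity M X"
  using conn_remove_ge[of "{}" "{}" X] not_induced[of X] by (simp add: matroid_M)

lemma card_smaller: "z \<in> ground M \<Longrightarrow> card (ground M - {z}) < card (ground M)"
  using matroidD(1)[OF matroid_M] by (meson card_Diff1_less)

lemma induced_delete:
  assumes "z \<in> ground M" "minor N (delete M {z})"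
  obtains X where "A \<subseteq> X" "X \<subseteq> ground M - {z} - B" "connectivity (delete M {z}) X = int k - 1"
proof -
  have "minor (delete M {z}) M" using minorI[of "{}" M "{z}"] assms(1) matroid_M by simp
  then have "delete M {z} \<in> \<M>" by (rule minor_class[OF M_in])
  from smaller[OF _ decomposer_hypotheses_axioms this assms(2)] card_smaller[OF assms(1)]
  obtain X where "A \<subseteq> X \<and> X \<subseteq> ground M - {z} - B \<and> connectivity (delete M {z}) X = int k - 1"
    by (auto simp only: ground_simps)
  then show ?thesis by (intro that[of X]) simp_all
qed

lemma induced_contract:
  assumes "z \<in> ground M" "minor N (contract M {z})"
  obtains X where "A \<subseteq> X" "X \<subseteq> ground M - {z} - B" "connectivity (contract M {z}) X = int k - 1"
proof -
  have "minor (contract M {z}) M" using minorI[of "{z}" M "{}"] assms(1) matroid_M 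
    by (simp add: matroid_contract)
  then have "contract M {z} \<in> \<M>" by (rule minor_class[OF M_in])
  from smaller[OF _ decomposer_hypotheses_axioms this assms(2)] card_smaller[OF assms(1)]
  obtain X where "A \<subseteq> X \<and> X \<subseteq> ground M - {z} - B \<and> connectivity (contract M {z}) X = int k - 1"
    by (auto simp only: ground_simps)
  then show ?thesis by (intro that[of X]) simp_all
qed

lemma not_both:
  assumes z: "z \<in> ground M" "z \<notin> A" "z \<notin> B"
  shows "\<not> (minor N (delete M {z}) \<and> minor N (contract M {z}))"
proof
  assume a: "minor N (delete M {z}) \<and> minor N (contract M {z})"
  obtain X where X: "A \<subseteq> X" "X \<subseteq> ground M - {z} - B" "connectivity (delete M {z}) X = int k - 1"
    using induced_delete z(1) a by blast
  obtain Y where Y: "A \<subseteq> Y" "Y \<subseteq> ground M - {z} - B" "connectivity (contract M {z}) Y = int k - 1"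
    using induced_contract z(1) a by blast
  note M = matroid_M
  have sub: "X \<subseteq> ground M - {z}" "Y \<subseteq> ground M - {z}" using X(2) Y(2) by auto
  have x: "int (rank M X) + int (rank M (ground M - {z} - X)) - int (rank M (ground M - {z})) = int k - 1"
    using X(3) connectivity_delete[OF M sub(1)] by simp
  have y: "int (rank M (Y \<union> {z})) + int (rank M (ground M - Y)) - int (rank M (ground M)) - int (rank M {z}) = int k - 1"
    using Y(3) connectivity_contract[OF M _ sub(2)] z(1) by simp
  have "int k \<le> connectivity M (X \<inter> Y)" by (rule conn_M_ge) (use X Y in auto)
  moreover have "int k \<le> connectivity M (X \<union> Y \<union> {z})" by (rule conn_M_ge) (use X Y z in auto)
  moreover have "rank M (X \<inter> Y) + rank M (X \<union> Y \<union> {z}) \<le> rank M X + rank M (Y \<union> {z})"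
    by (rule rank_submod'[OF M]) auto
  moreover have "rank M (ground M - (X \<union> Y \<union> {z})) + rank M (ground M - (X \<inter> Y))
      \<le> rank M (ground M - {z} - X) + rank M (ground M - Y)"
    by (rule rank_submod'[OF M]) (use X Y z in auto)
  moreover have "rank M (ground M - {z}) \<le> rank M (ground M)" by (rule rank_mono[OF M]) auto
  moreover have "rank M {z} \<le> 1" using rank_le_card[OF M, of "{z}"] by simp
  ultimately show False using x y unfolding connectivity_def by linarith
qed

lemma indep_C: "indep M C"
proof (rule ccontr)
  assume "\<not> indep M C"
  then obtain K where K: "circuit M K" "K \<subseteq> C" using circuit_subset[OF matroid_M CD(1)] by blast
  then have "K \<noteq> {}" using matroidD(3)[OF matroid_M] by (auto simp: circuit_def)
  then obtain c where c: "c \<in> K" by blast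
  note M = matroid_M
  have fK: "finite K" using K(2) finite_CD finite_subset by blast
  have "indep M (K - {c})" "\<not> indep M K" using K(1) c by (auto simp: circuit_def)
  then have "rank M (K - {c}) = card K - 1" "rank M K \<noteq> card K"
    using rank_indep[OF M] indep_iff_rank[OF M fK] c fK by auto
  moreover have "rank M K \<le> card K" "rank M (K - {c}) \<le> rank M K"
    using rank_le_card[OF M fK] rank_mono[OF M, of "K - {c}" K] by auto
  moreover have "insert c (K - {c}) = K" using c by auto
  ultimately have "rank M (insert c (K - {c})) = rank M (K - {c})" by simp
  then have "rank M (insert c (C - {c})) = rank M (C - {c})"
    by (rule rank_insert_mono[OF M, rotated]) (use K in auto)
  then have N: "N = remove M (C - {c}) (insert c D)"
    using remove_swap_loop[OF M CD(1,3)] K(2) c N_eq by auto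
  have "minor N (delete M {c})" unfolding N
    by (rule minor_delete[OF M]) (use CD K c in auto)
  moreover have "minor N (contract M {c})" unfolding N_eq
    by (rule minor_contract[OF M]) (use CD K c in auto)
  moreover have "c \<in> ground M" "c \<notin> A" "c \<notin> B" using K(2) c CD(1) disjoint by auto
  ultimately show False using not_both by simp
qed

lemma coindep_D: "indep (dual M) D"
  by (rule min_counterexample.indep_C[OF dual_min_counterexample])

lemma rank_C: "C' \<subseteq> C \<Longrightarrow> rank M C' = card C'"
  using rank_indep[OF matroid_M] matroidD(4)[OF matroid_M indep_C] by blast

lemma rank_without_D: "D' \<subseteq> D \<Longrightarrow> rank M (ground M - D') = rank M (ground M)"
  using rank_dual[OF matroid_M, of D'] CD rank_indep[OF matroid_dual[OF matroid_M]]
    matroidD(4)[OF matroid_dual[OF matroid_M] coindep_D, of D'] by auto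

text \<open>A sign vector places each element outside \<open>N\<close> on the side of \<open>A\<close> (1), on the side of \<open>B\<close>
  (-1), or removes it in the way that leads to \<open>N\<close> (0).\<close>

definition tight :: "('a \<Rightarrow> int) \<Rightarrow> bool" where
  "tight s \<longleftrightarrow> (\<forall>x\<in>C \<union> D. s x = -1 \<or> s x = 0 \<or> s x = 1) \<and>
    connectivity (remove M {x\<in>C. s x = 0} {x\<in>D. s x = 0}) (A \<union> {x\<in>C \<union> D. s x = 1}) = int k - 1"

definition side_A :: "('a \<Rightarrow> int) \<Rightarrow> 'a set" where
  "side_A s = A \<union> {x\<in>C. 0 \<le> s x} \<union> {x\<in>D. 0 < s x}"

definition side_B :: "('a \<Rightarrow> int) \<Rightarrow> 'a set" where
  "side_B s = B \<union> {x\<in>C. s x \<le> 0} \<union> {x\<in>D. s x < 0}"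

definition order :: "('a \<Rightarrow> int) \<Rightarrow> int" where
  "order s = int (rank M (side_A s)) + int (rank M (side_B s)) - int (rank M (ground M))
    - int (card {x\<in>C. s x = 0})"

lemma connectivity_order:
  assumes "\<And>x. x \<in> C \<union> D \<Longrightarrow> s x = -1 \<or> s x = 0 \<or> s x = 1"
  shows "connectivity (remove M {x\<in>C. s x = 0} {x\<in>D. s x = 0}) (A \<union> {x\<in>C \<union> D. s x = 1}) = order s"
proof -
  let ?C = "{x\<in>C. s x = 0}" and ?D = "{x\<in>D. s x = 0}" and ?X = "A \<union> {x\<in>C \<union> D. s x = 1}"
  have "connectivity (remove M ?C ?D) ?X = int (rank M (?X \<union> ?C)) + int (rank M (ground M - ?D - ?X))
      - int (rank M (ground M - ?D)) - int (rank M ?C)"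
    by (rule connectivity_remove[OF matroid_M]) (use CD disjoint ground_M in auto)
  moreover have "side_A s = A \<union> {x\<in>C. s x = 0 \<or> s x = 1} \<union> {x\<in>D. s x = 1}"
    unfolding side_A_def using assms by (intro arg_cong2[of _ _ _ _ "(\<union>)"] refl Collect_cong) fastforce+
  moreover have "side_B s = B \<union> {x\<in>C. s x \<noteq> 1} \<union> {x\<in>D. s x \<noteq> 0 \<and> s x \<noteq> 1}"
    unfolding side_B_def using assms by (intro arg_cong2[of _ _ _ _ "(\<union>)"] refl Collect_cong) fastforce+
  moreover have "?X \<union> ?C = A \<union> {x\<in>C. s x = 0 \<or> s x = 1} \<union> {x\<in>D. s x = 1}" by auto
  moreover have "ground M - ?D - ?X = B \<union> {x\<in>C. s x \<noteq> 1} \<union> {x\<in>D. s x \<noteq> 0 \<and> s x \<noteq> 1}"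
    unfolding ground_M using disjoint CD(3) ground_N(2) by auto
  ultimately show ?thesis using rank_C[of ?C] rank_without_D[of ?D] by (simp add: order_def)
qed

lemma tight_iff:
  "tight s \<longleftrightarrow> (\<forall>x\<in>C \<union> D. s x = -1 \<or> s x = 0 \<or> s x = 1) \<and> order s = int k - 1"
  using connectivity_order[of s] unfolding tight_def by (intro conj_cong refl) simp

lemma order_ge:
  assumes "\<And>x. x \<in> C \<union> D \<Longrightarrow> s x = -1 \<or> s x = 0 \<or> s x = 1"
  shows "int k - 1 \<le> order s"
proof -
  have "int k - 1 \<le> connectivity (remove M {x\<in>C. s x = 0} {x\<in>D. s x = 0}) (A \<union> {x\<in>C \<union> D. s x = 1})"
    by (rule conn_remove_ge) (use disjoint ground_M ground_N(2) CD(3) in auto)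
  then show ?thesis using connectivity_order[of s] assms by simp
qed

lemma order_submod:
  "order (\<lambda>x. max (s x) (t x)) + order (\<lambda>x. min (s x) (t x)) \<le> order s + order t"
proof -
  let ?M = "\<lambda>x. max (s x) (t x)" and ?m = "\<lambda>x. min (s x) (t x)"
  have "side_A ?M = side_A s \<union> side_A t" "side_A ?m = side_A s \<inter> side_A t"
    "side_B ?M = side_B s \<inter> side_B t" "side_B ?m = side_B s \<union> side_B t"
    unfolding side_A_def side_B_def using disjoint CD(3) by (auto simp: le_max_iff_disj min_le_iff_disj
      less_max_iff_disj min_less_iff_disj)
  moreover have "card {x\<in>C. ?M x = 0} + card {x\<in>C. ?m x = 0} = card {x\<in>C. s x = 0} + card {x\<in>C. t x = 0}"
  proof -
    have c: "card {x\<in>C. P x} = (\<Sum>x\<in>C. if P x then 1 else 0)" for P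
      using finite_CD(1) by (simp add: sum.If_cases Int_def)
    show ?thesis unfolding c sum.distrib[symmetric]
      by (rule sum.cong) (auto simp: max_def min_def)
  qed
  ultimately show ?thesis
    using rank_submod[OF matroid_M, of "side_A s" "side_A t"]
      rank_submod[OF matroid_M, of "side_B s" "side_B t"] unfolding order_def by simp
qed

lemma tight_max_min:
  assumes "tight s" "tight t"
  shows "tight (\<lambda>x. max (s x) (t x))" "tight (\<lambda>x. min (s x) (t x))"
proof -
  have v: "\<forall>x\<in>C \<union> D. max (s x) (t x) = -1 \<or> max (s x) (t x) = 0 \<or> max (s x) (t x) = 1"
    "\<forall>x\<in>C \<union> D. min (s x) (t x) = -1 \<or> min (s x) (t x) = 0 \<or> min (s x) (t x) = 1"
    using assms unfolding tight_def max_def min_def by auto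
  then show "tight (\<lambda>x. max (s x) (t x))" "tight (\<lambda>x. min (s x) (t x))"
    using order_submod[of s t] order_ge[of "\<lambda>x. max (s x) (t x)"] order_ge[of "\<lambda>x. min (s x) (t x)"]
      assms unfolding tight_iff by auto
qed

lemma tight_restrict:
  assumes s: "tight s"
  shows "tight (\<lambda>x. if x \<in> S then s x else 0)"
proof -
  let ?t = "\<lambda>x. if x \<in> S then s x else 0"
  let ?C = "{x\<in>C. s x = 0}" and ?D = "{x\<in>D. s x = 0}" and ?X = "A \<union> {x\<in>C \<union> D. s x = 1}"
  let ?C' = "{x\<in>C. ?t x = 0}" and ?D' = "{x\<in>D. ?t x = 0}" and ?X' = "A \<union> {x\<in>C \<union> D. ?t x = 1}"
  have v: "\<forall>x\<in>C \<union> D. ?t x = -1 \<or> ?t x = 0 \<or> ?t x = 1" using s by (auto simp: tight_def)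
  have "connectivity (remove M ?C' ?D') ?X' \<le> connectivity (remove M ?C ?D) ?X"
  proof (rule connectivity_remove_mono[OF matroid_M])
    show "?C' \<subseteq> ground M" "?C' \<inter> ?D' = {}" "?C \<subseteq> ?C'" "?D \<subseteq> ?D'" using CD by auto
    show "?X \<subseteq> ground M - ?C - ?D" using ground_M disjoint CD(3) by auto
    show "?X' = ?X - ?C' - ?D'" using v disjoint CD(3) by auto
  qed
  then show ?thesis using s v order_ge[of ?t] connectivity_order[of ?t] by (auto simp: tight_def)
qed

lemma tight_zero: "tight (\<lambda>_. 0)"
  using conn_N N_eq by (simp add: tight_def)

lemma tight_has_zero: 
  assumes "tight s" shows "\<exists>x\<in>C \<union> D. s x = 0"
proof (rule ccontr)
  assume "\<not> ?thesis"
  then have e: "{x\<in>C. s x = 0} = {}" "{x\<in>D. s x = 0} = {}" by auto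
  have "connectivity M (A \<union> {x\<in>C \<union> D. s x = 1}) = int k - 1"
    using assms[unfolded tight_def e contract_empty[OF matroid_M] delete_empty[OF matroid_M]] by (rule conjunct2)
  moreover have "A \<union> {x\<in>C \<union> D. s x = 1} \<subseteq> ground M - B" using ground_M disjoint ground_N(2) by auto
  ultimately show False using not_induced by blast
qed

lemma tight_from_set:
  assumes z: "z \<in> C \<union> D" and X: "A \<subseteq> X" "X \<subseteq> ground M - {z} - B"
    and c: "connectivity (remove M (C \<inter> {z}) (D \<inter> {z})) X = int k - 1"
  shows "tight (\<lambda>x. if x = z then 0 else if x \<in> X then 1 else -1)"
proof -
  let ?s = "\<lambda>x. if x = z then 0 else if x \<in> X then 1 else (-1::int)"
  have "{x\<in>C. ?s x = 0} = C \<inter> {z}" "{x\<in>D. ?s x = 0} = D \<inter> {z}" by auto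
  moreover have "A \<union> {x\<in>C \<union> D. ?s x = 1} = X" using X ground_M by auto
  ultimately show ?thesis using c by (simp add: tight_def)
qed

lemma tight_single_zero:
  assumes z: "z \<in> C \<union> D"
  shows "\<exists>s. tight s \<and> s z = 0 \<and> (\<forall>x\<in>C \<union> D - {z}. s x \<noteq> 0)"
proof -
  have zM: "z \<in> ground M" using z CD by auto
  have "\<exists>X. A \<subseteq> X \<and> X \<subseteq> ground M - {z} - B \<and>
    connectivity (remove M (C \<inter> {z}) (D \<inter> {z})) X = int k - 1"
  proof (cases "z \<in> C")
    case True
    then have e: "C \<inter> {z} = {z}" "D \<inter> {z} = {}" using CD(3) by auto
    have "minor N (contract M {z})" unfolding N_eq using True by (intro minor_contract matroid_M CD)
    from induced_contract[OF zM this] show ?thesis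
      unfolding e delete_empty[OF matroid_contract[OF matroid_M]] by metis
  next
    case False
    then have e: "C \<inter> {z} = {}" "D \<inter> {z} = {z}" and zD: "z \<in> D" using z by auto
    have "minor N (delete M {z})" unfolding N_eq using zD by (intro minor_delete matroid_M CD)
    from induced_delete[OF zM this] show ?thesis
      unfolding e contract_empty[OF matroid_M] by metis
  qed
  then obtain X where X: "A \<subseteq> X" "X \<subseteq> ground M - {z} - B"
    "connectivity (remove M (C \<inter> {z}) (D \<inter> {z})) X = int k - 1" by (elim exE conjE)
  show ?thesis using tight_from_set[OF z X] by (intro exI[of _ "\<lambda>x. if x = z then 0 else if x \<in> X then 1 else -1"]) auto
qed

sublocale sign_vectors "C \<union> D" "Collect tight"
proof
  show "finite (C \<union> D)" using finite_CD by simp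
  show "s x = -1 \<or> s x = 0 \<or> s x = 1" if "s \<in> Collect tight" "x \<in> C \<union> D" for s x
    using that by (auto simp: tight_def)
  show "\<exists>s\<in>Collect tight. s z = 0 \<and> (\<forall>x\<in>C \<union> D - {z}. s x \<noteq> 0)" if "z \<in> C \<union> D" for z
    using tight_single_zero[OF that] by auto
qed (use tight_max_min tight_has_zero in auto)

text \<open>Consecutive elements are removed in opposite ways: if both were deleted or both contracted, the
  order would be additive in the two signs, because each sign then changes only one of the sides.\<close>

lemma alternate:
  assumes vw: "v \<in> C \<union> D" "w \<in> C \<union> D" "v \<noteq> w"
    and v: "tight (\<lambda>x. if x = v then 1 else 0)" and w: "tight (\<lambda>x. if x = w then -1 else 0)"
    and n: "\<not> tight (\<lambda>x. if x = v then 1 else if x = w then -1 else 0)"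
  shows "v \<in> D \<longleftrightarrow> w \<in> C"
proof (rule ccontr)
  let ?v = "\<lambda>x. if x = v then 1 else (0::int)" and ?w = "\<lambda>x. if x = w then -1 else (0::int)"
  let ?t = "\<lambda>x. if x = v then 1 else if x = w then -1 else (0::int)"
  assume "(v \<in> D) \<noteq> (w \<in> C)"
  then consider "v \<in> D" "w \<in> D" "v \<notin> C" "w \<notin> C" | "v \<in> C" "w \<in> C" "v \<notin> D" "w \<notin> D"
    using vw CD(3) by blast
  then have "order ?t + order (\<lambda>_. 0) = order ?v + order ?w"
  proof cases
    case 1
    have *: "v \<noteq> x" "w \<noteq> x" if "x \<in> C" for x using 1 that by auto
    have "side_A ?t = side_A ?v" "side_A ?w = side_A (\<lambda>_. 0)"
      "side_B ?t = side_B ?w" "side_B ?v = side_B (\<lambda>_. 0)"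
      unfolding side_A_def side_B_def
      by (intro arg_cong2[of _ _ _ _ "(\<union>)"] refl Collect_cong conj_cong; use * vw(3) in force)+
    moreover have "{x\<in>C. ?t x = 0} = C" "{x\<in>C. ?v x = 0} = C" "{x\<in>C. ?w x = 0} = C"
      using * by fastforce+
    ultimately show ?thesis by (simp add: order_def)
  next
    case 2
    have *: "v \<noteq> x" "w \<noteq> x" if "x \<in> D" for x using 2 that by auto
    have "side_A ?t = side_A ?w" "side_A ?v = side_A (\<lambda>_. 0)"
      "side_B ?t = side_B ?v" "side_B ?w = side_B (\<lambda>_. 0)"
      unfolding side_A_def side_B_def
      by (intro arg_cong2[of _ _ _ _ "(\<union>)"] refl Collect_cong conj_cong; use * vw(3) in force)+
    moreover have "{x\<in>C. ?t x = 0} = C - {v, w}" "{x\<in>C. ?v x = 0} = C - {v}" "{x\<in>C. ?w x = 0} = C - {w}"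
      by auto
    moreover have "card (C - {v, w}) + 2 = card C" "card (C - {v}) + 1 = card C" "card (C - {w}) + 1 = card C"
      using card_Diff_add[OF finite_CD(1), of "{v, w}"] card_Diff_add[OF finite_CD(1), of "{v}"]
        card_Diff_add[OF finite_CD(1), of "{w}"] 2(1,2) vw(3) by simp_all
    ultimately show ?thesis by (simp add: order_def)
  qed
  then have "order ?t = int k - 1" using v w tight_zero by (simp add: tight_iff)
  then have "tight ?t" by (simp add: tight_iff)
  then show False using n by simp
qed

lemma successor:
  assumes s: "cut_at v s" and v: "v \<in> C \<union> D" and u: "u \<in> C \<union> D" "s u = -1"
  obtains w t where "w \<in> C \<union> D" "w \<noteq> v" "cut_at w t" "t v = 1" "v \<in> D \<longleftrightarrow> w \<in> C"
    "tight (\<lambda>x. if x = v then 1 else 0)" "tight (\<lambda>x. if x = w then -1 else 0)"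
    "\<not> tight (\<lambda>x. if x = v then 1 else if x = w then -1 else 0)"
proof -
  obtain w t where w: "w \<in> C \<union> D" "w \<noteq> v" "s w = -1" "cut_at w t" "t v = 1"
    "\<And>x. x \<in> C \<union> D \<Longrightarrow> x \<noteq> v \<Longrightarrow> x \<noteq> w \<Longrightarrow> t x = s x"
    using successor_exists[OF s v u] by blast
  let ?t = "\<lambda>x. if x = v then 1 else if x = w then -1 else (0::int)"
  have st: "tight s" "tight t" "s v = 0" "t w = 0" using s w(4) by (auto simp: cut_at_def)
  have 1: "tight (\<lambda>x. if x = v then 1 else 0)"
    using tight_restrict[OF st(2), of "{v}"] w(5) by (simp cong: if_cong)
  have 2: "tight (\<lambda>x. if x = w then -1 else 0)"
    using tight_restrict[OF st(1), of "{w}"] w(3) by (simp cong: if_cong)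
  have 3: "\<not> tight ?t"
  proof
    assume "tight ?t"
    then have "tight (\<lambda>x. min (max (s x) (?t x)) (t x))" using st tight_max_min by blast
    then obtain x where x: "x \<in> C \<union> D" "min (max (s x) (?t x)) (t x) = 0" using tight_has_zero by blast
    then show False using w(2,3,5,6) st(3,4) cut_sign[OF s x(1)] 
      by (cases "x = v"; cases "x = w") auto
  qed
  show ?thesis by (rule that[OF w(1,2,4,5) alternate[OF v w(1) w(2)[symmetric] 1 2 3] 1 2 3])
qed

end

section \<open>Exchanging parallel elements\<close>

lemma indep_contract_insert:
  assumes M: "matroid M" and e: "indep M {e}" and I: "indep (contract M {e}) I"
  shows "indep M (insert e I)"
proof -
  have g: "e \<in> ground M" "I \<subseteq> ground M - {e}"
    using matroidD(2)[OF M e] matroidD(2)[OF matroid_contract[OF M] I] by auto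
  have f: "finite I" using indep_finite[OF matroid_contract[OF M] I] .
  have "rank (contract M {e}) I + rank M {e} = rank M (I \<union> {e})"
    using rank_contract[OF M _ g(2)] g(1) by simp
  moreover have "e \<notin> I" using g(2) by auto
  ultimately have "rank M (insert e I) = card (insert e I)"
    using rank_indep[OF M e] rank_indep[OF matroid_contract[OF M] I] f by simp
  then show ?thesis using indep_iff_rank[OF M] f by simp
qed

lemma indep_contract_imp:
  assumes M: "matroid M" and e: "e \<in> ground M" and I: "indep (contract M {e}) I"
  shows "indep M I"
proof -
  have g: "I \<subseteq> ground M - {e}" using matroidD(2)[OF matroid_contract[OF M] I] by auto
  have f: "finite I" using indep_finite[OF matroid_contract[OF M] I] .
  have "rank (contract M {e}) I + rank M {e} = rank M (I \<union> {e})"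
    using rank_contract[OF M _ g] e by simp
  moreover have "rank M (I \<union> {e}) \<le> rank M I + rank M {e}"
    using rank_submod[OF M, of I "{e}"] by simp
  ultimately have "card I \<le> rank M I" using rank_indep[OF matroid_contract[OF M] I] by simp
  then show ?thesis using indep_iff_rank[OF M f] rank_le_card[OF M f] by simp
qed

lemma connectivity_delete_spanned:
  assumes M: "matroid M" and X: "e \<in> ground M" "X \<subseteq> ground M - {e}"
    and r: "rank M (insert e (ground M - X - {e})) = rank M (ground M - X - {e})"
  shows "connectivity M X = connectivity (delete M {e}) X"
proof -
  have "rank M (insert e (ground M - {e})) = rank M (ground M - {e})"
    by (rule rank_insert_mono[OF M _ r]) auto
  moreover have "insert e (ground M - {e}) = ground M" "insert e (ground M - X - {e}) = ground M - X"
    "ground M - {e} - X = ground M - X - {e}"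
    using X by auto
  ultimately show ?thesis
    using r connectivity_delete[OF M X(2)] by (simp add: connectivity_def)
qed

lemma dependent_pair_spanned:
  assumes M: "matroid M" and b: "indep M {b}" "\<not> indep M {e, b}" "b \<in> Y"
  shows "rank M (insert e Y) = rank M Y"
proof (rule rank_insert_mono[OF M])
  show "{b} \<subseteq> Y" using b(3) by simp
  have ne: "e \<noteq> b" using b by auto
  have "rank M {e, b} \<noteq> 2" using indep_iff_rank[OF M, of "{e, b}"] b(2) ne by simp
  then show "rank M (insert e {b}) = rank M {b}"
    using rank_indep[OF M b(1)] rank_insert_le[OF M, of e "{b}"] rank_mono[OF M, of "{b}" "{e, b}"] by simp
qed

context min_counterexample
begin

lemma indep_C_single:
  assumes "c \<in> C" shows "indep (remove M (C - {c}) D) {c}"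
proof -
  have "c \<in> ground M - (C - {c}) - D" "C - {c} \<subseteq> ground M" using assms CD by auto
  then have "rank (remove M (C - {c}) D) {c} + rank M (C - {c}) = rank M ({c} \<union> (C - {c}))"
    by (intro rank_remove matroid_M) auto
  moreover have "{c} \<union> (C - {c}) = C" using assms by auto
  moreover have "card (C - {c}) + 1 = card C" using card_Diff_add[OF finite_CD(1), of "{c}"] assms by simp
  ultimately show ?thesis
    using rank_C[of C] rank_C[of "C - {c}"] indep_iff_rank[OF matroid_remove[OF matroid_M], of "{c}"] by auto
qed

lemma indep_D_single:
  assumes v: "v \<in> D" shows "indep (remove M C (D - {v})) {v}"
proof (rule ccontr)
  assume "\<not> ?thesis"
  then have "rank (remove M C (D - {v})) {v} \<noteq> 1"
    using indep_iff_rank[OF matroid_remove[OF matroid_M], of "{v}"] by simp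
  moreover have "{v} \<subseteq> ground M - C - (D - {v})" using v CD by auto
  then have "rank (remove M C (D - {v})) {v} + rank M C = rank M ({v} \<union> C)"
    by (intro rank_remove matroid_M CD)
  ultimately have r: "rank M (insert v C) = rank M C"
    using rank_insert_le[OF matroid_M, of v C] rank_mono[OF matroid_M, of C "insert v C"] by auto
  have vC: "v \<notin> C" using v CD(3) by auto
  have "remove M (insert v C) (D - {v}) = remove M (insert v C - {v}) (insert v (D - {v}))"
    by (rule remove_swap_loop[OF matroid_M]) (use v CD vC r in auto)
  then have N: "N = remove M (insert v C) (D - {v})" using N_eq vC v by (simp add: insert_absorb)
  have "minor N (contract M {v})" unfolding N
    by (rule minor_contract[OF matroid_M]) (use CD v in auto)
  moreover have "minor N (delete M {v})" unfolding N_eq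
    by (rule minor_delete[OF matroid_M CD v])
  moreover have "v \<in> ground M" "v \<notin> A" "v \<notin> B" using v CD(2) disjoint by auto
  ultimately show False using not_both by blast
qed

lemma side_zero: "side_A (\<lambda>_. 0) = A \<union> C" "side_B (\<lambda>_. 0) = B \<union> C"
  by (auto simp: side_A_def side_B_def)

lemma order_zero:
  "int (rank M (A \<union> C)) + int (rank M (B \<union> C)) - int (rank M (ground M)) - int (card C) = int k - 1"
  using tight_zero unfolding tight_iff order_def side_zero by simp

lemma relabel_parallel:
  assumes v: "v \<in> D" and a: "a \<in> A"
    and r: "\<And>X. C \<subseteq> X \<Longrightarrow> rank M (insert a X) = rank M (insert v X)"
  shows "relabel (transpose a v) N = remove M C (insert a (D - {v}))"
proof (rule matroid_eqI)
  let ?p = "transpose a v" let ?D = "insert a (D - {v})"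
  have bij: "bij ?p" by simp
  show "matroid (relabel ?p N)" by (rule matroid_relabel[OF bij matroid_N])
  show "matroid (remove M C ?D)" by (rule matroid_remove[OF matroid_M])
  have va: "v \<notin> ground N" "a \<in> ground N" using v a ground_N disjoint by auto
  then have gr: "?p ` ground N = insert v (ground N - {a})"
    unfolding transpose_def by force
  then have "ground (relabel ?p N) = insert v (ground N - {a})" by (simp add: ground_relabel[OF bij])
  also have "\<dots> = ground (remove M C ?D)" using ground_N ground_M disjoint v a CD by auto
  finally show g: "ground (relabel ?p N) = ground (remove M C ?D)" .
  fix X assume "X \<subseteq> ground (relabel ?p N)"
  then have X: "X \<subseteq> insert v (ground N - {a})" using gr by (simp add: ground_relabel[OF bij])
  then have XR: "X \<subseteq> ground M - C - ?D" using g gr by (simp add: ground_relabel[OF bij])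
  define Y where "Y = ?p ` X"
  have XY: "X = ?p ` Y" by (simp add: Y_def image_image)
  have Y: "Y \<subseteq> ground M - C - D \<and> rank M (Y \<union> C) = rank M (X \<union> C)"
  proof (cases "v \<in> X")
    case True
    then have "Y = insert a (X - {v})" using X unfolding Y_def transpose_def by force
    moreover from this have "Y \<union> C = insert a (X - {v} \<union> C)" "X \<union> C = insert v (X - {v} \<union> C)" 
      using True by auto
    ultimately show ?thesis using r[of "X - {v} \<union> C"] X va N_eq by auto
  next
    case False
    then have "Y = X" using X unfolding Y_def transpose_def by force
    then show ?thesis using X False N_eq by auto
  qed
  have "rank (relabel ?p N) X = rank N Y" unfolding XY by (rule rank_relabel[OF bij])
  moreover have "rank N Y + rank M C = rank M (Y \<union> C)"
    unfolding N_eq by (rule rank_remove) (use Y matroid_M CD in auto)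
  moreover have "rank (remove M C ?D) X + rank M C = rank M (X \<union> C)"
    by (rule rank_remove[OF matroid_M CD(1) XR])
  ultimately show "rank (relabel ?p N) X = rank (remove M C ?D) X" using Y by simp
qed

text \<open>If \<open>a\<close> and \<open>v\<close> were parallel, replacing \<open>a\<close> by \<open>v\<close> would give a copy of \<open>N\<close> that is a minor of
  \<open>M\<close> with \<open>a\<close> deleted, where its separation is induced. The successor \<open>w\<close> of \<open>v\<close> cannot be on either
  side of the inducing separation.\<close>

lemma indep_pair:
  assumes v: "v \<in> D" and a: "a \<in> A"
  shows "indep (remove M C (D - {v})) {a, v}"
proof (rule ccontr)
  let ?r = "rank M" let ?E = "ground M" let ?N1 = "remove M C (D - {v})"
  note M = matroid_M
  assume dep: "\<not> indep ?N1 {a, v}"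
  have av: "a \<noteq> v" "a \<notin> C" "a \<notin> D" "v \<notin> C" "v \<notin> A" "v \<notin> B" "a \<notin> B" "a \<in> ?E" "v \<in> ?E"
    using a v disjoint CD ground_M ground_N(2) by auto
  have rv: "?r (insert v C) = ?r C + 1"
    using rank_remove[OF M CD(1), of "{v}" "D - {v}"] av rank_indep[OF _ indep_D_single[OF v]]
      matroid_remove[OF M] by simp
  have "indep N {a, a}" using simple_N simple_matroid_iff[OF matroid_N] a ground_N(1) by blast
  then have ra: "?r (insert a C) = ?r C + 1"
    using rank_remove[OF M CD(1), of "{a}" D] av rank_indep[OF matroid_N, of "{a}"] by (simp add: N_eq)
  have "rank ?N1 {a, v} \<noteq> 2" 
    using dep indep_iff_rank[OF matroid_remove[OF M], of "{a, v}"] av by simp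
  moreover have "rank ?N1 {a, v} \<le> 2"
    using rank_le_card[OF matroid_remove[OF M, of C "D - {v}"], of "{a, v}"] av by (simp add: numeral_2_eq_2)
  moreover have "rank ?N1 {a, v} + ?r C = ?r (insert a (insert v C))"
    using rank_remove[OF M CD(1), of "{a, v}" "D - {v}"] av by simp
  moreover have "?r (insert v C) \<le> ?r (insert a (insert v C))" by (rule rank_mono[OF M]) auto
  ultimately have rav: "?r (insert a (insert v C)) = ?r C + 1" using rv by linarith
  have cl: "?r (insert a (insert v X)) = ?r (insert v X)" "?r (insert v (insert a X)) = ?r (insert a X)"
    if "C \<subseteq> X" for X
    using rank_insert_mono[OF M, of "insert v C" "insert v X" a] 
      rank_insert_mono[OF M, of "insert a C" "insert a X" v] that rav ra rv by (auto simp: insert_commute)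
  then have swap: "?r (insert a X) = ?r (insert v X)" if "C \<subseteq> X" for X
    using that by (metis insert_commute)
  let ?v = "\<lambda>x. if x = v then 1 else (0::int)"
  have sv: "side_A ?v = insert v (A \<union> C)" "side_B ?v = B \<union> C" "{x \<in> C. ?v x = 0} = C"
    using v av by (auto simp: side_A_def side_B_def)
  have "insert a (A \<union> C) = A \<union> C" using a by auto
  then have "?r (insert v (A \<union> C)) = ?r (A \<union> C)" using cl(2)[of "A \<union> C"] by simp
  then have "order ?v = int k - 1" using order_zero by (simp add: order_def sv)
  then have tv: "tight ?v" by (simp add: tight_iff)
  have vZ: "v \<in> C \<union> D" using v by simp
  obtain s where s: "cut_at v s" using cut_ex[OF vZ] by blast
  have "\<exists>u\<in>C \<union> D. s u = -1"
  proof (rule ccontr)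
    assume n: "\<not> ?thesis"
    have "tight (\<lambda>x. max (s x) (?v x))" using tight_max_min(1) s tv by (simp add: cut_at_def)
    then obtain x where x: "x \<in> C \<union> D" "max (s x) (?v x) = 0" using tight_has_zero by blast
    have "s x = 1" if "x \<noteq> v" using cut_sign[OF s x(1) that] n x(1) by auto
    then show False using x(2) by (cases "x = v") auto
  qed
  then obtain u where u: "u \<in> C \<union> D" "s u = -1" by blast
  obtain w t where w: "w \<in> C \<union> D" "w \<noteq> v" "cut_at w t" "t v = 1" "v \<in> D \<longleftrightarrow> w \<in> C"
      "tight ?v" and tw: "tight (\<lambda>x. if x = w then -1 else 0)"
    and ntw: "\<not> tight (\<lambda>x. if x = v then 1 else if x = w then -1 else 0)"
    by (rule successor[OF s vZ u])
  have wC: "w \<in> C" using w(5) v by simp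
  have wn: "w \<notin> A" "w \<notin> B" "w \<notin> D" "w \<in> ?E" "w \<noteq> a" using wC disjoint CD av by auto
  define D' where "D' = insert a (D - {v})"
  define A' where "A' = insert v (A - {a})"
  have N': "relabel (transpose a v) N = remove M C D'"
    unfolding D'_def by (rule relabel_parallel[OF v a swap])
  have im: "transpose a v ` A = A'" "transpose a v ` B = B"
    using a av unfolding A'_def transpose_def by force+
  have hyp: "decomposer_hypotheses \<M> k (remove M C D') A' B"
    using hypotheses_relabel[of "transpose a v"] unfolding N' im by simp
  have CD': "D' \<subseteq> ?E" "C \<inter> D' = {}" "a \<in> D'" "C \<inter> A' = {}" "D' \<inter> A' = {}"
    using CD av disjoint unfolding D'_def A'_def by auto
  have conn': "connectivity (remove M C D') A' = int k - 1"
    using hyp by (rule decomposer_hypotheses.conn_N)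
  have "minor (delete M {a}) M" using minorI[of "{}" M "{a}"] av(8) M by simp
  then have "delete M {a} \<in> \<M>" by (rule minor_class[OF M_in])
  moreover have "minor (remove M C D') (delete M {a})"
    by (rule minor_delete[OF M CD(1) CD'(1-3)])
  ultimately obtain X where X: "A' \<subseteq> X" "X \<subseteq> ?E - {a} - B" "connectivity (delete M {a}) X = int k - 1"
    using smaller[OF _ hyp, of "delete M {a}"] card_smaller[OF av(8)] by auto
  have Xs: "X \<subseteq> ?E - {a}" using X(2) by auto
  show False
  proof (cases "w \<in> X")
    case True
    define W where "W = A \<union> {x\<in>C \<union> D. t x = 1}"
    have tz: "{x\<in>C. t x = 0} = {w}" "{x\<in>D. t x = 0} = {}"
      using w(1,3) wC wn by (auto simp: cut_at_def)
    have "tight t" using w(3) by (simp add: cut_at_def)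
    then have "connectivity (contract M {w}) W = int k - 1"
      unfolding tight_def tz W_def delete_empty[OF matroid_contract[OF M]] by blast
    moreover have W: "W \<subseteq> ?E - {w}" "W \<inter> B = {}" "a \<in> W" "v \<in> W" "A \<subseteq> W"
      using w(3,4) wn v a disjoint ground_N(2) ground_M by (auto simp: W_def cut_at_def)
    ultimately have y: "int (?r (W \<union> {w})) + int (?r (?E - W)) - int (?r ?E) - int (?r {w}) = int k - 1"
      using connectivity_contract[OF M, of "{w}" W] wn by simp
    have x: "int (?r X) + int (?r (?E - {a} - X)) - int (?r (?E - {a})) = int k - 1"
      using X(3) connectivity_delete[OF M Xs] by simp
    have 1: "int k \<le> connectivity M (X \<union> W)"
      by (rule conn_M_ge) (use X W in auto)
    have XW: "X \<inter> W \<subseteq> ?E - {w} - {a}" using Xs W(1) by auto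
    have "A' = X \<inter> W - C - D'"
      using X(1,2) W CD' ground_M unfolding D'_def A'_def by auto
    then have "connectivity (remove M C D') A' \<le> connectivity (remove M {w} {a}) (X \<inter> W)"
      using connectivity_remove_mono[OF M CD(1) CD'(2) _ _ XW] wC CD'(3) by simp
    moreover have "connectivity (remove M {w} {a}) (X \<inter> W) = int (?r (X \<inter> W \<union> {w})) 
        + int (?r (?E - {a} - X \<inter> W)) - int (?r (?E - {a})) - int (?r {w})"
      by (rule connectivity_remove[OF M _ _ XW]) (use wn in auto)
    moreover have "?r (X \<inter> W \<union> {w}) + ?r (X \<union> W) \<le> ?r X + ?r (W \<union> {w})"
      by (rule rank_submod'[OF M]) (use True in auto)
    moreover have "?r (?E - (X \<union> W)) + ?r (?E - {a} - X \<inter> W) \<le> ?r (?E - {a} - X) + ?r (?E - W)"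
      by (rule rank_submod'[OF M]) (use W in auto)
    ultimately show False using 1 x y conn' unfolding connectivity_def by linarith
  next
    case False
    define G where "G = C - {w}"
    have GC: "G \<subseteq> C" "insert w G = C" "C \<subseteq> A' \<union> B \<union> C" using wC by (auto simp: G_def)
    have "connectivity (remove M G D') A' \<le> connectivity (remove M {} {a}) X"
    proof (rule connectivity_remove_mono[OF M])
      show "A' = X - G - D'" using X(1,2) False CD' ground_M unfolding D'_def A'_def G_def by auto
    qed (use GC CD CD' Xs in auto)
    moreover have "connectivity (remove M G D') A' = int (?r (A' \<union> G)) + int (?r (?E - D' - A')) 
      - int (?r (?E - D')) - int (?r G)"
      by (rule connectivity_remove[OF M]) (use GC CD CD' av ground_M disjoint in \<open>auto simp: A'_def\<close>)
    moreover have "?E - D' - A' = B \<union> C" "?E - D' = insert v (A - {a} \<union> B \<union> C)"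
      "?E - D = insert a (A - {a} \<union> B \<union> C)"
      using ground_M disjoint ground_N(2) CD(3) av a v by (auto simp: D'_def A'_def)
    moreover have "?r (insert v (A - {a} \<union> B \<union> C)) = ?r (insert a (A - {a} \<union> B \<union> C))"
      by (rule swap[symmetric]) auto
    moreover have "?r (?E - D) = ?r ?E" by (rule rank_without_D) simp
    moreover have "connectivity (remove M {} {a}) X = int k - 1" using X(3) M by simp
    moreover have rG: "?r G + 1 = card C"
      using rank_C[OF GC(1)] card_Diff_add[OF finite_CD(1), of "{w}"] wC by (simp add: G_def)
    ultimately have z: "int (?r (A' \<union> G)) + int (?r (B \<union> C)) - int (?r ?E) - int (card C) + 1 \<le> int k - 1"
      by simp
    let ?w = "\<lambda>x. if x = w then -1 else (0::int)"
    let ?t = "\<lambda>x. if x = v then 1 else if x = w then -1 else (0::int)"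
    have sw: "side_A ?w = A \<union> G" "side_B ?w = B \<union> C" "{x\<in>C. ?w x = 0} = G"
      using wC wn by (auto simp: side_A_def side_B_def G_def)
    have st: "side_A ?t = insert v (A \<union> G)" "side_B ?t = B \<union> C" "{x\<in>C. ?t x = 0} = G"
      using wC wn v av by (auto simp: side_A_def side_B_def G_def)
    have cG: "card G + 1 = card C" using rG rank_C[OF GC(1)] by simp
    have "int (?r (A \<union> G)) + int (?r (B \<union> C)) - int (?r ?E) - int (card C) + 1 = int k - 1"
      using tw cG unfolding tight_iff order_def sw by simp
    then have rAG: "?r (A \<union> G) + 1 = ?r (A \<union> C)" using order_zero by linarith
    have "\<forall>x\<in>C \<union> D. ?t x = -1 \<or> ?t x = 0 \<or> ?t x = 1" by simp
    then have "order ?t \<noteq> int k - 1" "int k - 1 \<le> order ?t"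
      using ntw tight_iff[of ?t] order_ge[of ?t] by blast+
    then have "int k \<le> order ?t" by linarith
    then have "int k \<le> int (?r (insert v (A \<union> G))) + int (?r (B \<union> C)) - int (?r ?E) - int (card C) + 1"
      using cG unfolding order_def st by simp
    then have rvAG: "?r (A \<union> C) \<le> ?r (insert v (A \<union> G))" using order_zero by linarith
    have "rank N (A - {a}) + ?r C = ?r (A - {a} \<union> C)" "rank N A + ?r C = ?r (A \<union> C)"
      unfolding N_eq by (rule rank_remove[OF M CD(1)]; use disjoint ground_M in auto)+
    then have "?r (A - {a} \<union> C) = ?r (A \<union> C)" using no_coloop[OF a] by simp
    moreover have "A - {a} \<union> C = insert w (A - {a} \<union> G)" using GC(2) by auto
    ultimately have "?r (A \<union> C) \<le> ?r (A - {a} \<union> G) + 1"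
      using rank_insert_le[OF M, of w "A - {a} \<union> G"] by simp
    moreover have i: "insert a (A - {a} \<union> G) = A \<union> G" using a by auto
    moreover have "?r (A - {a} \<union> G) \<le> ?r (A \<union> G)" by (rule rank_mono[OF M]) auto
    ultimately have "?r (insert a (A - {a} \<union> G)) = ?r (A - {a} \<union> G)" using rAG by simp
    then have "?r (insert a (insert v (A - {a} \<union> G))) = ?r (insert v (A - {a} \<union> G))"
      by (rule rank_insert_mono[OF M, rotated]) auto
    moreover have "insert a (insert v (A - {a} \<union> G)) = insert v (A \<union> G)" 
      "insert v (A - {a} \<union> G) = A' \<union> G" using i by (auto simp: A'_def)
    ultimately have "?r (A' \<union> G) = ?r (insert v (A \<union> G))" by simp
    then show False using z rvAG order_zero by linarith
  qed
qed

section \<open>The first element\<close>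

lemma dual_pair:
  assumes c: "c \<in> C" and a: "a \<in> A"
  shows "indep (dual (remove M (C - {c}) D)) {a, c}"
proof -
  interpret d: min_counterexample "dual ` \<M>" k "dual N" A B "dual M" D C
    by (rule dual_min_counterexample)
  have "dual (remove M (C - {c}) D) = remove (dual M) D (C - {c})"
    by (rule dual_remove[OF matroid_M]) (use CD in auto)
  then show ?thesis using d.indep_pair[OF c a] by simp
qed

lemma dual_C_single:
  assumes c: "c \<in> C"
  shows "indep (dual (remove M (C - {c}) D)) {c}"
proof -
  interpret d: min_counterexample "dual ` \<M>" k "dual N" A B "dual M" D C
    by (rule dual_min_counterexample)
  have "dual (remove M (C - {c}) D) = remove (dual M) D (C - {c})"
    by (rule dual_remove[OF matroid_M]) (use CD in auto)
  then show ?thesis using d.indep_D_single[OF c] by simp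
qed

lemma dual_D_single:
  assumes v: "v \<in> D"
  shows "indep (dual (remove M C (D - {v}))) {v}"
proof -
  interpret d: min_counterexample "dual ` \<M>" k "dual N" A B "dual M" D C
    by (rule dual_min_counterexample)
  have "dual (remove M C (D - {v})) = remove (dual M) (D - {v}) C"
    by (rule dual_remove[OF matroid_M]) (use CD in auto)
  then show ?thesis using d.indep_C_single[OF v] by simp
qed

lemma tight_dual: "min_counterexample.tight k A (dual M) D C s \<longleftrightarrow> tight s"
proof -
  interpret d: min_counterexample "dual ` \<M>" k "dual N" A B "dual M" D C
    by (rule dual_min_counterexample)
  let ?C = "{x\<in>C. s x = 0}" and ?D = "{x\<in>D. s x = 0}" and ?X = "A \<union> {x\<in>C \<union> D. s x = 1}"
  have "remove (dual M) ?D ?C = dual (remove M ?C ?D)"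
    by (rule dual_remove[symmetric, OF matroid_M]) (use CD in auto)
  moreover have "?X \<subseteq> ground (remove M ?C ?D)"
    using ground_M disjoint CD(3) by auto
  ultimately have "connectivity (remove (dual M) ?D ?C) ?X = connectivity (remove M ?C ?D) ?X"
    using connectivity_dual[OF matroid_remove[OF matroid_M]] by simp
  then show ?thesis unfolding d.tight_def tight_def by (simp only: Un_commute[of D C])
qed

lemma first_not_deleted:
  assumes e: "e \<in> D" and s: "cut_at e s" and neg: "\<And>u. u \<in> C \<union> D \<Longrightarrow> u \<noteq> e \<Longrightarrow> s u = -1"
  shows False
proof -
  note M = matroid_M
  define N1 where "N1 = remove M C (D - {e})"
  have mN1: "matroid N1" unfolding N1_def by (rule matroid_remove[OF M])
  have en: "e \<notin> A" "e \<notin> B" "e \<notin> C" "e \<in> ground M" using e disjoint CD by auto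
  have gN1: "ground N1 = insert e (A \<union> B)" "e \<in> ground N1"
    using ground_M disjoint CD(3) e en by (auto simp: N1_def)
  have "minor N1 M" unfolding N1_def by (rule minorI) (use CD in auto)
  then have N1_in: "N1 \<in> \<M>" by (rule minor_class[OF M_in])
  have "remove N1 {} {e} = remove M (C \<union> {}) (D - {e} \<union> {e})"
    unfolding N1_def by (rule remove_remove[OF M]) (use CD in auto)
  moreover have "D - {e} \<union> {e} = D" using e by auto
  ultimately have del: "delete N1 {e} = N" using mN1 N_eq by simp
  have not_source: "connectivity N1 A \<noteq> int k - 1"
  proof
    let ?n = "\<lambda>x. if x = e then -1 else (0::int)"
    assume "connectivity N1 A = int k - 1"
    moreover have "{x\<in>C. ?n x = 0} = C" "{x\<in>D. ?n x = 0} = D - {e}" "{x\<in>C \<union> D. ?n x = 1} = {}"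
      using en by auto
    ultimately have "tight ?n" unfolding tight_def N1_def by simp
    then have "tight (\<lambda>x. min (s x) (?n x))" using tight_max_min(2) s by (simp add: cut_at_def)
    then obtain x where "x \<in> C \<union> D" "min (s x) (?n x) = 0" using tight_has_zero by blast
    then show False using neg[of x] s by (cases "x = e") (auto simp: cut_at_def)
  qed
  have ind_N: "indep N {x, y}" if "x \<in> ground N" "y \<in> ground N" for x y
    using simple_N simple_matroid_iff[OF matroid_N] that by blast
  have ind_N1: "indep N1 {x, y}" if "x \<in> ground N" "y \<in> ground N" for x y
    using ind_N[OF that] unfolding del[symmetric] by (simp add: delete_def)
  have e1: "indep N1 {e}" unfolding N1_def by (rule indep_D_single[OF e])
  have pair_e: "indep N1 {e, x}" if x: "x \<in> ground N" for x
  proof (cases "x \<in> A")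
    case True
    then show ?thesis using indep_pair[OF e True] by (simp add: N1_def insert_commute)
  next
    case False
    then have xB: "x \<in> B" using x ground_N by auto
    show ?thesis
    proof (rule ccontr)
      assume "\<not> indep N1 {e, x}"
      then have "rank N1 (insert e B) = rank N1 B"
        using dependent_pair_spanned[OF mN1 _ _ xB] ind_N1[OF x x] by simp
      moreover have "ground N1 - A - {e} = B" using gN1 en ground_N(2) by auto
      ultimately have "connectivity N1 A = connectivity N A"
        using connectivity_delete_spanned[OF mN1 gN1(2), of A] gN1(1) en del by auto
      then show False using conn_N not_source by simp
    qed
  qed
  have simple_N1: "simple_matroid N1"
    unfolding simple_matroid_iff[OF mN1]
    using ind_N1 pair_e e1 gN1(1) ground_N(1) by (metis insertE insert_absorb2 insert_commute)
  have ext_N1: "simple_extension N1 e N"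
    using simple_N1 gN1(2) del by (simp add: simple_extension_def)
  show False
  proof (cases "C \<union> D = {e}")
    case True
    then have "C = {}" "D = {e}" using e en by auto
    then have "N1 = M" by (simp add: N1_def M)
    then have "connectivity M A = int k - 1 \<or> connectivity M (A \<union> {e}) = int k - 1"
      using ext[OF N1_in ext_N1] by simp
    moreover have "A \<subseteq> ground M - B" "A \<union> {e} \<subseteq> ground M - B"
      using ground_M en ground_N(2) by auto
    ultimately show False using not_induced by blast
  next
    case False
    then obtain u where u: "u \<in> C \<union> D" "u \<noteq> e" using e by blast
    have eZ: "e \<in> C \<union> D" using e by simp
    obtain f t where f: "f \<in> C \<union> D" "f \<noteq> e" "cut_at f t" "t e = 1" "e \<in> D \<longleftrightarrow> f \<in> C"
      and te: "tight (\<lambda>x. if x = e then 1 else 0)"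
      and "tight (\<lambda>x. if x = f then -1 else 0)"
      and ntef: "\<not> tight (\<lambda>x. if x = e then 1 else if x = f then -1 else 0)"
      by (rule successor[OF s eZ u(1) neg[OF u]])
    have fC: "f \<in> C" using f(5) e by simp
    have fn: "f \<notin> A" "f \<notin> B" "f \<notin> D" "f \<in> ground M" "f \<noteq> e" using fC disjoint CD e by auto
    define M2 where "M2 = remove M (C - {f}) (D - {e})"
    define N2 where "N2 = remove M (C - {f}) D"
    have mM2: "matroid M2" and mN2: "matroid N2"
      unfolding M2_def N2_def by (rule matroid_remove[OF M])+
    have gM2: "ground M2 = insert e (insert f (A \<union> B))"
      using ground_M disjoint CD(3) e fC by (auto simp: M2_def)
    have "minor M2 M" unfolding M2_def by (rule minorI) (use CD in auto)
    then have M2_in: "M2 \<in> \<M>" by (rule minor_class[OF M_in])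
    have "remove M2 {f} {} = remove M (C - {f} \<union> {f}) (D - {e} \<union> {})"
      unfolding M2_def by (rule remove_remove[OF M]) (use CD fC in auto)
    moreover have "C - {f} \<union> {f} = C" using fC by auto
    ultimately have con_M2: "contract M2 {f} = N1" using mM2 by (simp add: N1_def matroid_contract)
    have "remove M2 {} {e} = remove M (C - {f} \<union> {}) (D - {e} \<union> {e})"
      unfolding M2_def by (rule remove_remove[OF M]) (use CD e in auto)
    moreover have "D - {e} \<union> {e} = D" using e by auto
    ultimately have del_M2: "delete M2 {e} = N2" using mM2 by (simp add: N2_def)
    have nc: "connectivity M2 (A \<union> {e}) \<noteq> int k - 1"
    proof
      let ?t = "\<lambda>x. if x = e then 1 else if x = f then -1 else (0::int)"
      assume "connectivity M2 (A \<union> {e}) = int k - 1"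
      moreover have "{x\<in>C. ?t x = 0} = C - {f}" "{x\<in>D. ?t x = 0} = D - {e}" "{x\<in>C \<union> D. ?t x = 1} = {e}"
        using en fn e by auto
      ultimately have "tight ?t" unfolding tight_def M2_def by simp
      then show False using ntef by simp
    qed
    have "{x\<in>C. (if x = e then 1 else (0::int)) = 0} = C" "{x\<in>D. (if x = e then 1 else (0::int)) = 0} = D - {e}"
      "{x\<in>C \<union> D. (if x = e then 1 else (0::int)) = 1} = {e}"
      using en e by auto
    then have cN1: "connectivity N1 (A \<union> {e}) = int k - 1"
      using te unfolding tight_def N1_def by simp
    let ?R = "dual M2"
    have mR: "matroid ?R" by (rule matroid_dual[OF mM2])
    have R_del: "delete ?R {f} = dual N1" using dual_contract[OF mM2, of "{f}"] con_M2 by simp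
    have R_con: "contract ?R {e} = dual N2" using dual_delete[OF mM2, of "{e}"] del_M2 by simp
    have N1_con: "contract (dual N1) {e} = dual N" using dual_delete[OF mN1, of "{e}"] del by simp
    have mdN1: "matroid (dual N1)" by (rule matroid_dual[OF mN1])
    have dN1_e: "indep (dual N1) {e}" unfolding N1_def by (rule dual_D_single[OF e])
    have R_e: "indep ?R {e}" using dN1_e unfolding R_del[symmetric] by (simp add: delete_def)
    have R_pair: "indep ?R {x, y}" if "x \<in> insert e (A \<union> B)" "y \<in> insert e (A \<union> B)" for x y
    proof -
      have N: "indep (dual N) {x, y}" if "x \<in> A \<union> B" "y \<in> A \<union> B" for x y
        using cosimple_N that ground_N(1)
        unfolding cosimple_iff_dual simple_matroid_iff[OF matroid_dual[OF matroid_N]] by simp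
      have 1: "indep (dual N1) {x, y}" if "x \<in> A \<union> B" "y \<in> A \<union> B" for x y
        by (rule indep_contract_imp[OF mdN1, of e]) (use N[OF that] N1_con gN1 in auto)
      have 2: "indep (dual N1) {e, y}" if "y \<in> A \<union> B" for y
        by (rule indep_contract_insert[OF mdN1 dN1_e]) (use N[OF that that] N1_con in simp)
      have "indep (dual N1) {x, y}"
        using that 1 2 dN1_e by (metis insertE insert_absorb2 insert_commute)
      then show ?thesis unfolding R_del[symmetric] by (simp add: delete_def)
    qed
    have N2_f: "indep (dual N2) {f}" unfolding N2_def by (rule dual_C_single[OF fC])
    have R_f: "indep ?R {f}"
      by (rule indep_contract_imp[OF mR, of e]) (use N2_f R_con gM2 in auto)
    have R_ef: "indep ?R {e, f}"
      by (rule indep_contract_insert[OF mR R_e]) (use N2_f R_con in simp)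
    have N2_af: "indep (dual N2) {a, f}" if "a \<in> A" for a
      unfolding N2_def by (rule dual_pair[OF fC that])
    have R_eaf: "indep ?R (insert e {a, f})" if "a \<in> A" for a
      by (rule indep_contract_insert[OF mR R_e]) (use N2_af[OF that] R_con in simp)
    have R_af: "indep ?R {f, a}" if "a \<in> A" for a
      by (rule matroidD(4)[OF mR R_eaf[OF that]]) auto
    have R_bf: "indep ?R {f, b}" if b: "b \<in> B" for b
    proof (rule ccontr)
      assume "\<not> indep ?R {f, b}"
      then have "rank ?R (insert f B) = rank ?R B"
        using dependent_pair_spanned[OF mR _ _ b] R_pair[of b b] b by simp
      moreover have "ground ?R - (A \<union> {e}) - {f} = B" using gM2 en fn ground_N(2) by auto
      ultimately have "connectivity ?R (A \<union> {e}) = connectivity (dual N1) (A \<union> {e})"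
        using connectivity_delete_spanned[OF mR, of f "A \<union> {e}"] gM2 fn R_del by auto
      moreover have "connectivity ?R (A \<union> {e}) = connectivity M2 (A \<union> {e})"
        by (rule connectivity_dual[OF mM2]) (use gM2 in auto)
      moreover have "connectivity (dual N1) (A \<union> {e}) = connectivity N1 (A \<union> {e})"
        by (rule connectivity_dual[OF mN1]) (use gN1 in auto)
      ultimately show False using nc cN1 by simp
    qed
    have R_fx: "indep ?R {f, x}" if x: "x \<in> ground M2" for x
    proof -
      consider "x = e" | "x = f" | "x \<in> A" | "x \<in> B" using x gM2 by auto
      then show ?thesis
      proof cases
        case 1
        have "{f, e} = {e, f}" by auto
        then show ?thesis using R_ef 1 by simp
      next
        case 2
        then show ?thesis using R_f by simp
      next
        case 3
        then show ?thesis by (rule R_af)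
      next
        case 4
        then show ?thesis by (rule R_bf)
      qed
    qed
    have "cosimple_matroid M2"
      unfolding cosimple_iff_dual simple_matroid_iff[OF mR]
    proof (intro ballI)
      fix x y assume xy: "x \<in> ground ?R" "y \<in> ground ?R"
      consider "x = f" | "y = f" | "x \<in> insert e (A \<union> B)" "y \<in> insert e (A \<union> B)"
        using xy gM2 by auto
      then show "indep ?R {x, y}"
      proof cases
        case 1
        then show ?thesis using R_fx[of y] xy by simp
      next
        case 2
        then show ?thesis using R_fx[of x] xy by (simp add: insert_commute)
      next
        case 3
        then show ?thesis by (rule R_pair)
      qed
    qed
    then have "cosimple_coextension M2 f N1"
      using con_M2 gM2 by (simp add: cosimple_coextension_def)
    from coext_ext[OF M2_in this ext_N1] con_M2 not_source nc
    obtain g where g: "g \<in> A" "triad M2 {e, f, g} \<or> triangle M2 {e, f, g}" by auto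
    have "\<not> triad M2 {e, f, g}"
      using R_eaf[OF g(1)] by (auto simp: triad_def circuit_def insert_commute)
    moreover have "\<not> triangle M2 {e, f, g}"
    proof
      assume "triangle M2 {e, f, g}"
      then have c: "circuit M2 {e, f, g}" by (simp add: triangle_def)
      have "{f} \<subset> {e, f, g}" using fn g(1) by auto
      then have "indep M2 {f}" using c by (simp add: circuit_def)
      moreover have "indep (contract M2 {f}) {e, g}"
        using pair_e[of g] g(1) ground_N(1) con_M2 by simp
      ultimately have "indep M2 (insert f {e, g})" by (rule indep_contract_insert[OF mM2])
      then show False using c by (simp add: circuit_def insert_commute)
    qed
    ultimately show False using g(2) by blast
  qed
qed

lemma no_min_counterexample: False
proof (cases "C \<union> D = {}")
  case True
  then have "N = M" using N_eq matroid_M by simp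
  then show False using conn_N not_induced[of A] ground_N by auto
next
  case False
  then obtain v s where v: "v \<in> C \<union> D" "cut_at v s" "\<And>u. u \<in> C \<union> D \<Longrightarrow> u \<noteq> v \<Longrightarrow> s u = -1"
    using first_exists by metis
  show False
  proof (cases "v \<in> D")
    case True
    then show False using first_not_deleted[OF _ v(2,3)] by blast
  next
    case False
    then have vC: "v \<in> C" using v(1) by simp
    interpret d: min_counterexample "dual ` \<M>" k "dual N" A B "dual M" D C
      by (rule dual_min_counterexample)
    have "d.cut_at v s" using v(2) by (auto simp: d.cut_at_def cut_at_def tight_dual)
    then show False by (rule d.first_not_deleted[OF vC]) (use v(3) in auto)
  qed
qed

end

lemma separation_induced:
  assumes "decomposer_hypotheses \<M> k N A B" "M \<in> \<M>" "minor N M"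
  shows "\<exists>X. A \<subseteq> X \<and> X \<subseteq> ground M - B \<and> connectivity M X = int k - 1"
  using assms
proof (induction "card (ground M)" arbitrary: \<M> N A B M rule: less_induct)
  case less
  interpret decomposer_hypotheses \<M> k N A B by (rule less.prems)
  obtain C D where CD: "C \<subseteq> ground M" "D \<subseteq> ground M" "C \<inter> D = {}" "N = remove M C D"
    using less.prems(3) unfolding minor_def by metis
  show ?case
  proof (rule ccontr)
    assume n: "\<not> ?thesis"
    have "min_counterexample \<M> k N A B M C D"
    proof
      show "connectivity M X \<noteq> int k - 1" if "A \<subseteq> X" "X \<subseteq> ground M - B" for X
        using n that by metis
      show "\<exists>X. A' \<subseteq> X \<and> X \<subseteq> ground M' - B' \<and> connectivity M' X = int k - 1"
        if "card (ground M') < card (ground M)" "decomposer_hypotheses \<M>' k N' A' B'"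
          "M' \<in> \<M>'" "minor N' M'" for \<M>' :: "'a indep_system set" and N' A' B' M'
        by (rule less.hyps[OF that])
    qed (fact less.prems(2) CD)+
    then show False by (rule min_counterexample.no_min_counterexample)
  qed
qed

theorem theorem1p1:
  fixes \<M> :: "'a indep_system set"
    and N :: "'a indep_system"
    and A B :: "'a set"
    and k :: nat
  assumes "\<forall>M\<in>\<M>. matroid M"
    and "minor_closed \<M>"
    and "iso_closed \<M>"
    and "k \<ge> 1"
    and "N \<in> \<M>"
    and "simple_matroid N"
    and "cosimple_matroid N"
    and "exact_k_separation k N A B"
    and "\<exists>\<C>. (\<forall>C\<in>\<C>. circuit N C) \<and> A = \<Union>\<C>"
    and "\<exists>\<C>. (\<forall>C\<in>\<C>. cocircuit N C) \<and> A = \<Union>\<C>"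
    and i: "\<And>M e. \<lbrakk>M \<in> \<M>; simple_extension M e N\<rbrakk> \<Longrightarrow>
          connectivity M A = int k - 1 \<or> connectivity M (A \<union> {e}) = int k - 1"
    and ii: "\<And>M f. \<lbrakk>M \<in> \<M>; cosimple_coextension M f N\<rbrakk> \<Longrightarrow>
          connectivity M A = int k - 1 \<or> connectivity M (A \<union> {f}) = int k - 1"
    and iii: "\<And>M e f. \<lbrakk>M \<in> \<M>;
          (\<exists>N'. cosimple_coextension M f N' \<and> simple_extension N' e N) \<or>
          (\<exists>N'. simple_extension M e N' \<and> cosimple_coextension N' f N)\<rbrakk> \<Longrightarrow>
          (connectivity (contract M {f}) A = int k - 1 \<and>
           connectivity (delete M {e}) A = int k - 1)
          \<or>
          (connectivity (contract M {f}) A = int k - 1 \<and>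
           connectivity (delete M {e}) (A \<union> {f}) = int k - 1 \<and>
           (connectivity M (A \<union> {f}) = int k - 1 \<or>
            (\<exists>g\<in>A. triad M {e, f, g} \<or> triangle M {e, f, g})))
          \<or>
          (connectivity (contract M {f}) (A \<union> {e}) = int k - 1 \<and>
           connectivity (delete M {e}) A = int k - 1 \<and>
           (connectivity M (A \<union> {e}) = int k - 1 \<or>
            (\<exists>g\<in>A. triad M {e, f, g} \<or> triangle M {e, f, g})))
          \<or>
          (connectivity (contract M {f}) (A \<union> {e}) = int k - 1 \<and>
           connectivity (delete M {e}) (A \<union> {f}) = int k - 1 \<and>
           (\<exists>g\<in>A. triangle M {e, f, g} \<or> triad M {e, f, g}))"
  shows "\<forall>M\<in>\<M>. \<forall>N' \<phi>. minor N' M \<and> matroid_iso \<phi> N N' \<longrightarrow>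
           k_decomposer k N' M (\<phi> ` A) (\<phi> ` B)"
proof -
  have mat: "\<And>M. M \<in> \<M> \<Longrightarrow> matroid M" using assms(1) by blast
  have mN: "matroid N" by (rule mat[OF assms(5)])
  have sep: "A \<union> B = ground N" "A \<inter> B = {}" "k \<le> card A" "k \<le> card B" "connectivity N A = int k - 1"
    using assms(8) by (auto simp: exact_k_separation_def k_separation_def)
  have span: "rank P (A - {a}) = rank P A"
    if P: "matroid P" and c: "\<exists>\<C>. (\<forall>C\<in>\<C>. circuit P C) \<and> A = \<Union>\<C>" and a: "a \<in> A" for P a
  proof -
    obtain K where K: "circuit P K" "a \<in> K" "K \<subseteq> A" using c a by blast
    have fK: "finite K" using K(1) matroidD(1)[OF P] finite_subset unfolding circuit_def by blast
    have i: "insert a (K - {a}) = K" using K(2) by auto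
    have "indep P (K - {a})" "\<not> indep P K" using K(1,2) by (auto simp: circuit_def)
    then have "rank P (K - {a}) = card K - 1" "rank P K \<noteq> card K"
      using rank_indep[OF P] indep_iff_rank[OF P fK] K(2) fK by auto
    then have "rank P (insert a (K - {a})) = rank P (K - {a})"
      using rank_le_card[OF P fK] rank_mono[OF P, of "K - {a}" K] i by auto
    then have "rank P (insert a (A - {a})) = rank P (A - {a})"
      by (rule rank_insert_mono[OF P, rotated]) (use K in auto)
    then show ?thesis using a by (simp add: insert_absorb)
  qed
  have hyp: "decomposer_hypotheses \<M> k N A B"
  proof
    show "relabel \<pi> M \<in> \<M>" if "M \<in> \<M>" "bij \<pi>" for M \<pi>
      using assms(3) that matroid_iso_relabel[OF that(2)] matroid_relabel[OF that(2) mat[OF that(1)]]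
      unfolding iso_closed_def by blast
    show "M' \<in> \<M>" if "M \<in> \<M>" "minor M' M" for M M'
      using assms(2) that unfolding minor_closed_def by blast
    show "rank N (A - {a}) = rank N A" if "a \<in> A" for a
      by (rule span[OF mN assms(9) that])
    show "rank (dual N) (A - {a}) = rank (dual N) A" if "a \<in> A" for a
      by (rule span[OF matroid_dual[OF mN] assms(10) that])
    show "connectivity (contract M {f}) A = int k - 1 \<or> connectivity M (A \<union> {e}) = int k - 1 \<or>
        (\<exists>g\<in>A. triad M {e, f, g} \<or> triangle M {e, f, g})"
      if "M \<in> \<M>" "cosimple_coextension M f N'" "simple_extension N' e N" for M e f N'
      using iii[OF that(1), of f e] that(2,3) by blast
    show "connectivity (delete M {e}) A = int k - 1 \<or> connectivity M (A \<union> {f}) = int k - 1 \<or>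
        (\<exists>g\<in>A. triad M {e, f, g} \<or> triangle M {e, f, g})"
      if "M \<in> \<M>" "simple_extension M e N'" "cosimple_coextension N' f N" for M e f N'
      using iii[OF that(1), of f e] that(2,3) by blast
  qed (use mat assms(5-7) sep i ii in auto)
  show ?thesis
  proof (intro ballI allI impI, elim conjE)
    fix M N' \<phi>
    assume M: "M \<in> \<M>" and min: "minor N' M" and iso: "matroid_iso \<phi> N N'"
    have mM: "matroid M" by (rule mat[OF M])
    have mN': "matroid N'" using min matroid_remove[OF mM] unfolding minor_def by blast
    have bb: "bij_betw \<phi> (ground N) (ground N')" using iso by (simp add: matroid_iso_def)
    obtain \<pi> where \<pi>: "bij \<pi>" "\<And>x. x \<in> ground N \<Longrightarrow> \<pi> x = \<phi> x"
      using extend_to_bij[OF matroidD(1)[OF mN] matroidD(1)[OF mN'] bb] by blast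
    have im: "\<pi> ` X = \<phi> ` X" if "X \<subseteq> ground N" for X
      by (rule image_cong[OF refl]) (use \<pi>(2) that in blast)
    have AB: "\<pi> ` A = \<phi> ` A" "\<pi> ` B = \<phi> ` B" by (rule im; use sep in blast)+
    have g': "ground N' = \<pi> ` ground N" using bb im[of "ground N"] by (simp add: bij_betw_def)
    have "N' = relabel \<pi> N"
    proof (rule relabel_eqI[OF \<pi>(1) g'])
      fix X
      show "indep N' (\<pi> ` X) \<longleftrightarrow> indep N X"
      proof (cases "X \<subseteq> ground N")
        case True
        then show ?thesis using iso im[OF True] by (simp add: matroid_iso_def)
      next
        case False
        then have "\<not> \<pi> ` X \<subseteq> ground N'" using g' image_sub[OF \<pi>(1)] by simp
        then show ?thesis using False matroidD(2)[OF mN] matroidD(2)[OF mN'] by blast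
      qed
    qed
    then interpret h: decomposer_hypotheses \<M> k N' "\<phi> ` A" "\<phi> ` B"
      using decomposer_hypotheses.hypotheses_relabel[OF hyp \<pi>(1)] AB by simp
    have card: "k \<le> card (\<phi> ` A)" "k \<le> card (\<phi> ` B)"
      using sep AB card_relabel[OF \<pi>(1)] by metis+
    obtain X where X: "\<phi> ` A \<subseteq> X" "X \<subseteq> ground M - \<phi> ` B" "connectivity M X = int k - 1"
      using separation_induced[OF h.decomposer_hypotheses_axioms M min] by blast
    have gM: "ground N' \<subseteq> ground M" using min unfolding minor_def by auto
    then have Y: "\<phi> ` B \<subseteq> ground M - X" using X(2) h.ground_N by auto
    have fin: "finite X" "finite (ground M - X)"
      using matroidD(1)[OF mM] X(2) finite_subset[of X "ground M"] by auto
    have "exact_k_separation k M X (ground M - X)"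
      using X card card_mono[OF fin(1) X(1)] card_mono[OF fin(2) Y]
      by (auto simp: exact_k_separation_def k_separation_def)
    moreover have "exact_k_separation k N' (\<phi> ` A) (\<phi> ` B)"
      using h.ground_N h.conn_N card by (auto simp: exact_k_separation_def k_separation_def)
    ultimately show "k_decomposer k N' M (\<phi> ` A) (\<phi> ` B)"
      unfolding k_decomposer_def using min X(1) Y by blast
  qed
qed

end
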